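(* Let $\mu\in\Delta^+_l\setminus\Pi$ and $I\in\mathfrak{Ab}_\mu$. Then the number of abelian ideals $I'\in\mathfrak{Ab}$ covering $I$ in $\mathfrak{Ab}$ with $I'\notin\mathfrak{Ab}_\mu$ equals $\#\{\alpha\in\Pi:(\mu,\alpha)>0\}$. In particular, this number does not depend on $I$, and if $\Delta$ is simply laced it equals $\kappa(\mu)$, the number of roots covered by $\mu$ in the root poset $\Delta^+$.
   Context: Let $\Delta$ be an irreducible reduced root system in a real Euclidean space $V$ with inner product $(\ ,\ )$, positive roots $\Delta^+$, simple roots $\Pi=\{\alpha_1,\dots,\alpha_n\}$, highest root $\theta$; $\Delta^+$ carries the root order ($\gamma$ covers $\mu$ iff $\gamma-\mu\in\Pi$). $\Delta^+_l$ is the set of long positive roots. An upper ideal $I\subset\Delta^+$ is abelian if $\gamma'+\gamma''\notin\Delta^+$ for all $\gamma',\gamma''\in I$; $\mathfrak{Ab}$ is the poset of abelian upper ideals ordered by inclusion. Affine setting: $\widehat V=V\oplus\mathbb R\delta\oplus\mathbb R\lambda$ with inner product extended by $(\delta,V)=(\lambda,V)=(\delta,\delta)=(\lambda,\lambda)=0$, $(\delta,\lambda)=1$; positive affine roots $\widehat\Delta^+=\Delta^+\cup\{\mu+k\delta:\mu\in\Delta,k\ge1\}$; $\alpha_0=\delta-\theta$; $\widehat W$ generated by $s_i(x)=x-(x,\alpha_i^\vee)\alpha_i$ ($0\le i\le n$). For $w\in\widehat W$, $N(w)=\{\nu\in\widehat\Delta^+:w(\nu)\in-\widehat\Delta^+\}$;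 for each $I\in\mathfrak{Ab}$ there is a unique $w_I\in\widehat W$ with $N(w_I)=\{\delta-\gamma:\gamma\in I\}$. It is known that for $I\ne\varnothing$, $\tau(I):=w_I(2\delta-\theta)\in\Delta^+_l$; set $\mathfrak{Ab}_\mu=\tau^{-1}(\mu)$ for $\mu\in\Delta^+_l$. *)

theory Defs
  imports "HOL-Analysis.Analysis"
begin

definition root_system :: "'a::euclidean_space set \<Rightarrow> bool" where
  "root_system \<Phi> \<longleftrightarrow>
     finite \<Phi> \<and> span \<Phi> = UNIV \<and> 0 \<notin> \<Phi> \<and>
     (\<forall>\<alpha>\<in>\<Phi>. \<forall>\<beta>\<in>\<Phi>. \<beta> - (2 * (\<beta> \<bullet> \<alpha>) / (\<alpha> \<bullet> \<alpha>)) *\<^sub>R \<alpha> \<in> \<Phi>) \<and>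
     (\<forall>\<alpha>\<in>\<Phi>. \<forall>\<beta>\<in>\<Phi>. 2 * (\<beta> \<bullet> \<alpha>) / (\<alpha> \<bullet> \<alpha>) \<in> \<int>)"

definition reduced_roots :: "'a::euclidean_space set \<Rightarrow> bool" where
  "reduced_roots \<Phi> \<longleftrightarrow> (\<forall>\<alpha>\<in>\<Phi>. \<forall>c::real. c *\<^sub>R \<alpha> \<in> \<Phi> \<longrightarrow> c = 1 \<or> c = -1)"

definition irreducible_roots :: "'a::euclidean_space set \<Rightarrow> bool" where
  "irreducible_roots \<Phi> \<longleftrightarrow>
     \<Phi> \<noteq> {} \<and>
     \<not> (\<exists>A B. A \<noteq> {} \<and> B \<noteq> {} \<and> A \<union> B = \<Phi> \<and> A \<inter> B = {} \<and>
            (\<forall>\<alpha>\<in>A. \<forall>\<beta>\<in>B. \<alpha> \<bullet> \<beta> = 0))"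

definition simply_laced :: "'a::euclidean_space set \<Rightarrow> bool" where
  "simply_laced \<Phi> \<longleftrightarrow> (\<forall>\<alpha>\<in>\<Phi>. \<forall>\<beta>\<in>\<Phi>. norm \<alpha> = norm \<beta>)"

text \<open>The positive roots are determined by the set \<open>S\<close> of simple roots.\<close>

definition pos_roots :: "'a::euclidean_space set \<Rightarrow> 'a set \<Rightarrow> 'a set" where
  "pos_roots \<Phi> S = {\<gamma> \<in> \<Phi>. \<exists>c :: 'a \<Rightarrow> nat. \<gamma> = (\<Sum>\<alpha>\<in>S. real (c \<alpha>) *\<^sub>R \<alpha>)}"

definition simple_roots :: "'a::euclidean_space set \<Rightarrow> 'a set \<Rightarrow> bool" where
  "simple_roots \<Phi> S \<longleftrightarrow>
     S \<subseteq> \<Phi> \<and> independent S \<and> span S = UNIV \<and>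
     (\<forall>\<gamma>\<in>\<Phi>. \<gamma> \<in> pos_roots \<Phi> S \<or> - \<gamma> \<in> pos_roots \<Phi> S)"

definition long_pos_roots :: "'a::euclidean_space set \<Rightarrow> 'a set \<Rightarrow> 'a set" where
  "long_pos_roots \<Phi> S = {\<gamma> \<in> pos_roots \<Phi> S. \<forall>\<beta>\<in>\<Phi>. norm \<beta> \<le> norm \<gamma>}"

definition root_covers :: "'a::euclidean_space set \<Rightarrow> 'a set \<Rightarrow> 'a \<Rightarrow> 'a \<Rightarrow> bool" where
  "root_covers \<Phi> S \<gamma> \<mu> \<longleftrightarrow> \<gamma> \<in> pos_roots \<Phi> S \<and> \<mu> \<in> pos_roots \<Phi> S \<and> \<gamma> - \<mu> \<in> S"

definition root_le :: "'a::euclidean_space set \<Rightarrow> 'a set \<Rightarrow> 'a \<Rightarrow> 'a \<Rightarrow> bool" where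
  "root_le \<Phi> S = (\<lambda>\<mu> \<gamma>. root_covers \<Phi> S \<gamma> \<mu>)\<^sup>*\<^sup>*"

definition kappa :: "'a::euclidean_space set \<Rightarrow> 'a set \<Rightarrow> 'a \<Rightarrow> nat" where
  "kappa \<Phi> S \<mu> = card {\<nu>. root_covers \<Phi> S \<mu> \<nu>}"

definition highest_root :: "'a::euclidean_space set \<Rightarrow> 'a set \<Rightarrow> 'a" where
  "highest_root \<Phi> S =
     (THE \<theta>. \<theta> \<in> pos_roots \<Phi> S \<and> (\<forall>\<gamma>\<in>pos_roots \<Phi> S. root_le \<Phi> S \<gamma> \<theta>))"

definition upper_ideal :: "'a::euclidean_space set \<Rightarrow> 'a set \<Rightarrow> 'a set \<Rightarrow> bool" where
  "upper_ideal \<Phi> S I \<longleftrightarrow>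
     I \<subseteq> pos_roots \<Phi> S \<and>
     (\<forall>\<gamma>\<in>I. \<forall>\<nu>\<in>pos_roots \<Phi> S. root_le \<Phi> S \<gamma> \<nu> \<longrightarrow> \<nu> \<in> I)"

definition abelian_ideals :: "'a::euclidean_space set \<Rightarrow> 'a set \<Rightarrow> 'a set set" where
  "abelian_ideals \<Phi> S =
     {I. upper_ideal \<Phi> S I \<and> (\<forall>\<gamma>\<in>I. \<forall>\<gamma>'\<in>I. \<gamma> + \<gamma>' \<notin> pos_roots \<Phi> S)}"

definition ideal_covers :: "'a::euclidean_space set \<Rightarrow> 'a set \<Rightarrow> 'a set \<Rightarrow> 'a set \<Rightarrow> bool" where
  "ideal_covers \<Phi> S I' I \<longleftrightarrow>
     I' \<in> abelian_ideals \<Phi> S \<and> I \<in> abelian_ideals \<Phi> S \<and> I \<subset> I' \<and>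
     \<not> (\<exists>J\<in>abelian_ideals \<Phi> S. I \<subset> J \<and> J \<subset> I')"

text \<open>
  The triple \<open>(v, a, b)\<close> stands for \<open>v + a\<delta> + b\<lambda>\<close>. The form below is the indefinite one
  with \<open>(\<delta>,\<lambda>) = 1\<close>, not the inner product of the product type.
\<close>

type_synonym 'a affine_space = "'a \<times> real \<times> real"

fun aff_form :: "'a::euclidean_space affine_space \<Rightarrow> 'a affine_space \<Rightarrow> real" where
  "aff_form (v, a, b) (v', a', b') = v \<bullet> v' + a * b' + b * a'"

definition emb :: "'a::euclidean_space \<Rightarrow> 'a affine_space" where
  "emb v = (v, 0, 0)"

definition delta :: "'a::euclidean_space affine_space" where
  "delta = (0, 1, 0)"

definition pos_affine_roots :: "'a::euclidean_space set \<Rightarrow> 'a set \<Rightarrow> 'a affine_space set" where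
  "pos_affine_roots \<Phi> S =
     emb ` pos_roots \<Phi> S \<union> {emb \<mu> + real k *\<^sub>R delta | \<mu> k. \<mu> \<in> \<Phi> \<and> k \<ge> 1}"

definition simple_affine_roots :: "'a::euclidean_space set \<Rightarrow> 'a set \<Rightarrow> 'a affine_space set" where
  "simple_affine_roots \<Phi> S = insert (delta - emb (highest_root \<Phi> S)) (emb ` S)"

definition aff_reflection ::
  "'a::euclidean_space affine_space \<Rightarrow> 'a affine_space \<Rightarrow> 'a affine_space" where
  "aff_reflection \<alpha> x = x - (2 * aff_form x \<alpha> / aff_form \<alpha> \<alpha>) *\<^sub>R \<alpha>"

text \<open>The generators are involutions, so their products already form a group.\<close>

inductive_set affine_weyl ::
  "'a::euclidean_space set \<Rightarrow> 'a set \<Rightarrow> ('a affine_space \<Rightarrow> 'a affine_space) set"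
  for \<Phi> S where
  id: "id \<in> affine_weyl \<Phi> S"
| refl: "\<lbrakk>\<alpha> \<in> simple_affine_roots \<Phi> S; w \<in> affine_weyl \<Phi> S\<rbrakk>
    \<Longrightarrow> aff_reflection \<alpha> \<circ> w \<in> affine_weyl \<Phi> S"

definition inversions ::
  "'a::euclidean_space set \<Rightarrow> 'a set \<Rightarrow> ('a affine_space \<Rightarrow> 'a affine_space) \<Rightarrow> 'a affine_space set" where
  "inversions \<Phi> S w = {\<nu> \<in> pos_affine_roots \<Phi> S. - w \<nu> \<in> pos_affine_roots \<Phi> S}"

definition ideal_elt ::
  "'a::euclidean_space set \<Rightarrow> 'a set \<Rightarrow> 'a set \<Rightarrow> 'a affine_space \<Rightarrow> 'a affine_space" where
  "ideal_elt \<Phi> S I =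
     (THE w. w \<in> affine_weyl \<Phi> S \<and> inversions \<Phi> S w = {delta - emb \<gamma> | \<gamma>. \<gamma> \<in> I})"

definition tau :: "'a::euclidean_space set \<Rightarrow> 'a set \<Rightarrow> 'a set \<Rightarrow> 'a affine_space" where
  "tau \<Phi> S I = ideal_elt \<Phi> S I (2 *\<^sub>R delta - emb (highest_root \<Phi> S))"

text \<open>
  The value \<open>tau I\<close> is a long positive root only for \<open>I \<noteq> {}\<close> (on the empty ideal it is
  \<open>2\<delta> - \<theta>\<close>); as an element of the affine space, that root appears as \<open>emb \<mu>\<close>.
\<close>

definition ideal_fibre :: "'a::euclidean_space set \<Rightarrow> 'a set \<Rightarrow> 'a \<Rightarrow> 'a set set" where
  "ideal_fibre \<Phi> S \<mu> = {I \<in> abelian_ideals \<Phi> S. I \<noteq> {} \<and> tau \<Phi> S I = emb \<mu>}"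

end

theory Submission
  imports Defs
begin

text \<open>
  The abelian ideals covering \<open>I\<close> are the sets \<open>I \<union> {\<gamma>}\<close> for which \<open>w\<^sub>I (\<delta> - \<gamma>)\<close> is a simple affine
  root \<open>\<alpha>\<^sub>i\<close>, and then \<open>\<tau> (I \<union> {\<gamma>}) = s\<^sub>i \<mu>\<close>. Hence the cover leaves the fibre iff \<open>(\<alpha>\<^sub>i, \<mu>) \<noteq> 0\<close>; as
  \<open>(\<alpha>\<^sub>i, \<mu>) = (\<delta> - \<gamma>, 2\<delta> - \<theta>) = (\<gamma>, \<theta>) \<ge> 0\<close> and \<open>(\<alpha>\<^sub>0, \<mu>) = - (\<theta>, \<mu>) \<le> 0\<close>, this means that \<open>\<alpha>\<^sub>i\<close> is a
  simple root of \<open>\<Delta>\<close> with \<open>(\<alpha>\<^sub>i, \<mu>) > 0\<close>.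

  Conversely let \<open>\<alpha> \<in> \<Pi>\<close> with \<open>(\<alpha>, \<mu>) > 0\<close>. Since \<open>\<mu>\<close> is long and not simple, \<open>\<mu> - \<alpha>\<close> is a positive root
  with \<open>(\<mu> - \<alpha>, \<mu>) > 0\<close>. A positive root \<open>\<nu>\<close> with \<open>(\<nu>, \<mu>) > 0\<close> has \<open>w\<^sub>I\<^sup>-\<^sup>1 \<nu> = v + k\<delta>\<close> with
  \<open>(v, \<theta>) < 0\<close>, which forces \<open>-v \<in> \<Delta>\<^sup>+\<close> and \<open>k \<ge> 1\<close>. The coefficients of \<open>\<delta>\<close> for \<open>\<alpha>\<close> and \<open>\<mu> - \<alpha>\<close> add up
  to that of \<open>w\<^sub>I\<^sup>-\<^sup>1 \<mu> = 2\<delta> - \<theta>\<close>, so both are 1, and \<open>w\<^sub>I\<^sup>-\<^sup>1 \<alpha> = \<delta> - \<gamma>\<close> with \<open>\<gamma> \<in> \<Delta>\<^sup>+\<close>.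
\<close>

lemma sum_in_Nats: "(\<And>x. x \<in> A \<Longrightarrow> f x \<in> \<nat>) \<Longrightarrow> sum f A \<in> (\<nat> :: real set)"
  by (induct A rule: infinite_finite_induct) auto

section \<open>The affine form and its reflections\<close>

lemma aff_form_commute: "aff_form x y = aff_form y x"
  by (cases x; cases y) (simp add: inner_commute)

lemma aff_form_add_left: "aff_form (x + y) z = aff_form x z + aff_form y z"
  by (cases x; cases y; cases z) (simp add: inner_add_left algebra_simps)

lemma aff_form_scale_left: "aff_form (c *\<^sub>R x) z = c * aff_form x z"
  by (cases x; cases z) (simp add: algebra_simps)

lemma aff_form_diff_left: "aff_form (x - y) z = aff_form x z - aff_form y z"
  using aff_form_add_left[of "x - y" y z] by simp

lemma aff_form_diff_right: "aff_form z (x - y) = aff_form z x - aff_form z y"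
  using aff_form_diff_left aff_form_commute by metis

lemma aff_form_scale_right: "aff_form z (c *\<^sub>R x) = c * aff_form z x"
  using aff_form_scale_left aff_form_commute by metis

lemma linear_aff_reflection: "linear (aff_reflection a)"
  by (rule linearI)
    (simp_all add: aff_reflection_def aff_form_add_left aff_form_scale_left algebra_simps add_divide_distrib)

lemma aff_reflection_self: "aff_form a a \<noteq> 0 \<Longrightarrow> aff_reflection a a = - a"
  by (simp add: aff_reflection_def scaleR_2)

lemma aff_reflection_form:
  "aff_form a a \<noteq> 0 \<Longrightarrow> aff_form (aff_reflection a x) (aff_reflection a y) = aff_form x y"
  by (simp add: aff_reflection_def aff_form_diff_left aff_form_diff_right
      aff_form_scale_left aff_form_scale_right aff_form_commute[of a y])

lemma aff_reflection_involution:
  assumes "aff_form a a \<noteq> 0"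
  shows "aff_reflection a (aff_reflection a x) = x"
proof -
  have "aff_form (aff_reflection a x) a = - aff_form x a"
    using assms by (simp add: aff_reflection_def aff_form_diff_left aff_form_scale_left)
  thus ?thesis by (simp add: aff_reflection_def[of a "aff_reflection a x"]) (simp add: aff_reflection_def)
qed

text \<open>Isometries preserve the coefficient in the reflection formula. This moves a simple
  reflection past a word and pulls a decomposition back along \<open>w\<close>.\<close>

lemma aff_reflection_conj:
  assumes "linear w" "\<And>x y. aff_form (w x) (w y) = aff_form x y"
  shows "w (aff_reflection a x) = aff_reflection (w a) (w x)"
  using assms(2) by (simp add: aff_reflection_def linear_diff[OF assms(1)] linear_scale[OF assms(1)])

section \<open>Words in affine reflections\<close>

definition word :: "'a::euclidean_space affine_space list \<Rightarrow> 'a affine_space \<Rightarrow> 'a affine_space" where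
  "word as = foldr (\<lambda>a w. aff_reflection a \<circ> w) as id"

lemma word_Nil [simp]: "word [] = id"
  and word_Cons [simp]: "word (a # as) = aff_reflection a \<circ> word as"
  by (simp_all add: word_def)

lemma word_append: "word (as @ bs) = word as \<circ> word bs"
  by (induction as) (simp_all add: comp_assoc)

lemma affine_weyl_word: "w \<in> affine_weyl \<Phi> S \<longleftrightarrow> (\<exists>as. set as \<subseteq> simple_affine_roots \<Phi> S \<and> w = word as)"
proof
  show "w \<in> affine_weyl \<Phi> S \<Longrightarrow> \<exists>as. set as \<subseteq> simple_affine_roots \<Phi> S \<and> w = word as"
  proof (induction rule: affine_weyl.induct)
    case id
    show ?case by (rule exI[of _ "[]"]) simp
  next
    case (refl \<alpha> w)
    then obtain as where "set as \<subseteq> simple_affine_roots \<Phi> S" "w = word as" by blast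
    thus ?case using refl by (intro exI[of _ "\<alpha> # as"]) simp
  qed
  have "word as \<in> affine_weyl \<Phi> S" if "set as \<subseteq> simple_affine_roots \<Phi> S" for as
    using that by (induction as) (simp_all add: affine_weyl.intros)
  thus "\<exists>as. set as \<subseteq> simple_affine_roots \<Phi> S \<and> w = word as \<Longrightarrow> w \<in> affine_weyl \<Phi> S" by blast
qed

lemma affine_weyl_comp: "v \<in> affine_weyl \<Phi> S \<Longrightarrow> w \<in> affine_weyl \<Phi> S \<Longrightarrow> v \<circ> w \<in> affine_weyl \<Phi> S"
  by (induction rule: affine_weyl.induct) (simp_all add: comp_assoc affine_weyl.intros)

section \<open>Finite root systems\<close>

locale based_root_system =
  fixes \<Phi> S :: "'a::euclidean_space set"
  assumes root_system: "root_system \<Phi>"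
    and reduced: "reduced_roots \<Phi>"
    and irreducible: "irreducible_roots \<Phi>"
    and simple: "simple_roots \<Phi> S"
begin

abbreviation P :: "'a set" where "P \<equiv> pos_roots \<Phi> S"

definition cartan :: "'a \<Rightarrow> 'a \<Rightarrow> real" where
  "cartan x y = 2 * (x \<bullet> y) / (y \<bullet> y)"

text \<open>As \<open>S\<close> is a basis of the whole space, these coordinates are linear without
  membership conditions.\<close>

definition coef :: "'a \<Rightarrow> 'a \<Rightarrow> real" where
  "coef \<alpha> v = representation S v \<alpha>"

lemma finite_roots: "finite \<Phi>" and zero_not_root: "0 \<notin> \<Phi>"
  using root_system unfolding root_system_def by auto

lemma reflect_root: "\<alpha> \<in> \<Phi> \<Longrightarrow> \<beta> \<in> \<Phi> \<Longrightarrow> \<beta> - cartan \<beta> \<alpha> *\<^sub>R \<alpha> \<in> \<Phi>"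
  using root_system unfolding root_system_def cartan_def by auto

lemma cartan_Ints: "\<alpha> \<in> \<Phi> \<Longrightarrow> \<beta> \<in> \<Phi> \<Longrightarrow> cartan \<beta> \<alpha> \<in> \<int>"
  using root_system unfolding root_system_def cartan_def by auto

lemma root_norm_pos: "\<alpha> \<in> \<Phi> \<Longrightarrow> \<alpha> \<bullet> \<alpha> > 0"
  using zero_not_root by auto

lemma cartan_self: "\<alpha> \<in> \<Phi> \<Longrightarrow> cartan \<alpha> \<alpha> = 2"
  using root_norm_pos[of \<alpha>] by (simp add: cartan_def)

lemma uminus_root: "\<alpha> \<in> \<Phi> \<Longrightarrow> - \<alpha> \<in> \<Phi>"
  using reflect_root[of \<alpha> \<alpha>] cartan_self[of \<alpha>] by (simp add: scaleR_2)

lemma uminus_root_iff: "- \<alpha> \<in> \<Phi> \<longleftrightarrow> \<alpha> \<in> \<Phi>"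
  using uminus_root[of \<alpha>] uminus_root[of "- \<alpha>"] by auto

lemma diff_root_swap: "\<alpha> - \<beta> \<in> \<Phi> \<longleftrightarrow> \<beta> - \<alpha> \<in> \<Phi>"
  using uminus_root_iff[of "\<alpha> - \<beta>"] by simp

lemma cartan_pos_ge_1:
  assumes "\<alpha> \<in> \<Phi>" "\<beta> \<in> \<Phi>" "\<beta> \<bullet> \<alpha> > 0"
  shows "cartan \<beta> \<alpha> \<ge> 1"
proof -
  have "cartan \<beta> \<alpha> > 0" using assms root_norm_pos[of \<alpha>] by (simp add: cartan_def)
  moreover obtain k where "cartan \<beta> \<alpha> = of_int k" using cartan_Ints[OF assms(1,2)] by (auto elim: Ints_cases)
  ultimately show ?thesis by simp
qed

text \<open>If the difference is not a root, neither Cartan integer is 1, as a reflection would then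
  yield it. Both are therefore at least 2, which makes the squared norm of
  \<open>\<alpha> - \<beta>\<close> nonpositive.\<close>

lemma root_diff:
  assumes \<alpha>: "\<alpha> \<in> \<Phi>" and \<beta>: "\<beta> \<in> \<Phi>" and pos: "\<alpha> \<bullet> \<beta> > 0" and ne: "\<alpha> \<noteq> \<beta>"
  shows "\<alpha> - \<beta> \<in> \<Phi>"
proof (rule ccontr)
  assume no: "\<alpha> - \<beta> \<notin> \<Phi>"
  have large: "y \<bullet> y \<le> x \<bullet> y"
    if xy: "x \<in> \<Phi>" "y \<in> \<Phi>" "x \<bullet> y > 0" "x - y \<notin> \<Phi>" for x y
  proof -
    obtain k where k: "cartan x y = of_int k" using cartan_Ints[OF xy(2,1)] by (rule Ints_cases)
    have "k \<ge> 1" using cartan_pos_ge_1[of y x] xy k by simp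
    moreover have "k \<noteq> 1" using reflect_root[of y x] xy k by auto
    ultimately have "cartan x y \<ge> 2" using k by simp
    thus ?thesis using root_norm_pos[OF xy(2)] by (simp add: cartan_def field_simps)
  qed
  have "\<beta> \<bullet> \<beta> \<le> \<alpha> \<bullet> \<beta>" using large[of \<alpha> \<beta>] assms no by auto
  moreover have "\<alpha> \<bullet> \<alpha> \<le> \<beta> \<bullet> \<alpha>"
    using large[of \<beta> \<alpha>] assms no by (auto simp: inner_commute diff_root_swap)
  ultimately have "(\<alpha> - \<beta>) \<bullet> (\<alpha> - \<beta>) \<le> 0" by (simp add: inner_diff inner_commute)
  moreover have "(\<alpha> - \<beta>) \<bullet> (\<alpha> - \<beta>) > 0" using ne by (simp del: inner_diff_left inner_diff_right)
  ultimately show False by linarith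
qed

lemma root_add:
  assumes "\<alpha> \<in> \<Phi>" "\<beta> \<in> \<Phi>" "\<alpha> \<bullet> \<beta> < 0" "\<alpha> \<noteq> - \<beta>"
  shows "\<alpha> + \<beta> \<in> \<Phi>"
  using root_diff[of \<alpha> "- \<beta>"] assms by (auto simp: uminus_root)

section \<open>Coordinates with respect to the simple roots\<close>

lemma simple_root: "\<alpha> \<in> S \<Longrightarrow> \<alpha> \<in> \<Phi>"
  and indep: "independent S" and span_S: "span S = UNIV"
  using simple unfolding simple_roots_def by auto

lemma finite_S: "finite S"
  using simple_root finite_roots by (meson finite_subset subsetI)

lemma coef_add [simp]: "coef \<alpha> (x + y) = coef \<alpha> x + coef \<alpha> y"
  and coef_diff [simp]: "coef \<alpha> (x - y) = coef \<alpha> x - coef \<alpha> y"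
  and coef_minus [simp]: "coef \<alpha> (- x) = - coef \<alpha> x"
  and coef_scale [simp]: "coef \<alpha> (c *\<^sub>R x) = c * coef \<alpha> x"
  unfolding coef_def using indep span_S
  by (simp_all add: real_vector.representation_add real_vector.representation_diff
      real_vector.representation_neg real_vector.representation_scale)

lemma coef_simple: "\<alpha> \<in> S \<Longrightarrow> coef \<beta> \<alpha> = (if \<beta> = \<alpha> then 1 else 0)"
  unfolding coef_def using indep by (simp add: real_vector.representation_basis)

lemma expand: "v = (\<Sum>\<alpha>\<in>S. coef \<alpha> v *\<^sub>R \<alpha>)"
  unfolding coef_def using indep span_S finite_S
  by (simp add: real_vector.sum_representation_eq)

lemma inner_expand: "v \<bullet> x = (\<Sum>\<alpha>\<in>S. coef \<alpha> v * (\<alpha> \<bullet> x))"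
  by (subst expand[of v]) (simp add: inner_sum_left)

lemma coef_sum:
  "\<beta> \<in> S \<Longrightarrow> coef \<beta> (\<Sum>\<alpha>\<in>S. c \<alpha> *\<^sub>R \<alpha>) = c \<beta>"
proof -
  assume b: "\<beta> \<in> S"
  have "coef \<beta> (\<Sum>\<alpha>\<in>T. c \<alpha> *\<^sub>R \<alpha>) = (\<Sum>\<alpha>\<in>T. if \<alpha> = \<beta> then c \<beta> else 0)" if "finite T" "T \<subseteq> S" for T
    using that
  proof (induction T)
    case empty
    \<comment> \<open>The instance \<open>coef_scale[of \<beta> 0 0]\<close> amounts to
      \<open>coef \<beta> 0 = 0\<close>.\<close>
    show ?case using coef_scale[of \<beta> 0 0] by simp
  qed (auto simp: coef_simple)
  from this[of S] show ?thesis using b finite_S by simp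
qed

lemma vec_eqI: "(\<And>\<alpha>. \<alpha> \<in> S \<Longrightarrow> coef \<alpha> x = coef \<alpha> y) \<Longrightarrow> x = y"
  by (subst expand[of x], subst expand[of y]) simp

lemma pos_root: "\<gamma> \<in> P \<Longrightarrow> \<gamma> \<in> \<Phi>"
  by (simp add: pos_roots_def)

lemma pos_coef_Nats: "\<gamma> \<in> P \<Longrightarrow> \<alpha> \<in> S \<Longrightarrow> coef \<alpha> \<gamma> \<in> \<nat>"
  unfolding pos_roots_def by (auto simp: coef_sum)

lemma pos_coef_nonneg: "\<gamma> \<in> P \<Longrightarrow> \<alpha> \<in> S \<Longrightarrow> coef \<alpha> \<gamma> \<ge> 0"
  using pos_coef_Nats[of \<gamma> \<alpha>] by (auto elim: Nats_cases)

lemma pos_or_neg: "\<gamma> \<in> \<Phi> \<Longrightarrow> \<gamma> \<in> P \<or> - \<gamma> \<in> P"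
  using simple unfolding simple_roots_def by auto

lemma pos_not_neg: "\<gamma> \<in> P \<Longrightarrow> - \<gamma> \<notin> P"
proof
  assume "\<gamma> \<in> P" "- \<gamma> \<in> P"
  hence "\<gamma> = 0" using pos_coef_nonneg[of \<gamma>] pos_coef_nonneg[of "- \<gamma>"] coef_scale[of _ 0 0]
    by (intro vec_eqI) (force)
  thus False using \<open>\<gamma> \<in> P\<close> pos_root zero_not_root by auto
qed

text \<open>The coordinates of a root never have opposite signs, so a single positive one decides
  its sign.\<close>

lemma pos_iff_coef_pos: "\<gamma> \<in> \<Phi> \<Longrightarrow> \<gamma> \<in> P \<longleftrightarrow> (\<exists>\<alpha>\<in>S. coef \<alpha> \<gamma> > 0)"
proof -
  assume r: "\<gamma> \<in> \<Phi>"
  have "\<exists>\<alpha>\<in>S. coef \<alpha> \<gamma> > 0" if p: "\<gamma> \<in> P"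
  proof (rule ccontr)
    assume "\<not> ?thesis"
    hence "\<And>\<alpha>. \<alpha> \<in> S \<Longrightarrow> coef \<alpha> \<gamma> = 0" using pos_coef_nonneg[OF p] by force
    hence "\<gamma> = 0" using coef_scale[of _ 0 0] by (intro vec_eqI) simp
    thus False using r zero_not_root by simp
  qed
  moreover have "\<gamma> \<in> P" if "\<alpha> \<in> S" "coef \<alpha> \<gamma> > 0" for \<alpha>
    using pos_or_neg[OF r] pos_coef_nonneg[of "- \<gamma>" \<alpha>] that by auto
  ultimately show ?thesis by blast
qed

lemma pos_coef_geI: "\<gamma> \<in> P \<Longrightarrow> \<nu> \<in> \<Phi> \<Longrightarrow> (\<And>\<alpha>. \<alpha> \<in> S \<Longrightarrow> coef \<alpha> \<gamma> \<le> coef \<alpha> \<nu>) \<Longrightarrow> \<nu> \<in> P"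
  using pos_iff_coef_pos[of \<gamma>] pos_iff_coef_pos[of \<nu>] pos_root[of \<gamma>] by (meson less_le_trans)

lemma simple_pos: "\<alpha> \<in> S \<Longrightarrow> \<alpha> \<in> P"
  using pos_iff_coef_pos[of \<alpha>] simple_root[of \<alpha>] by (force simp: coef_simple)

lemma pos_add: "\<gamma> \<in> P \<Longrightarrow> \<nu> \<in> P \<Longrightarrow> \<gamma> + \<nu> \<in> \<Phi> \<Longrightarrow> \<gamma> + \<nu> \<in> P"
  by (rule pos_coef_geI[of \<gamma>]) (auto simp: pos_coef_nonneg)

text \<open>The reflection changes the \<open>\<alpha>\<close>-coordinate alone, and by reducedness
  a positive root other than \<open>\<alpha>\<close> has another positive coordinate, which
  survives.\<close>

lemma reflect_simple_pos:
  assumes g: "\<gamma> \<in> P" and a: "\<alpha> \<in> S" and ne: "\<gamma> \<noteq> \<alpha>"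
  shows "\<gamma> - cartan \<gamma> \<alpha> *\<^sub>R \<alpha> \<in> P"
proof -
  have r: "\<gamma> - cartan \<gamma> \<alpha> *\<^sub>R \<alpha> \<in> \<Phi>" using reflect_root g a pos_root simple_root by blast
  have "\<exists>\<beta>\<in>S. \<beta> \<noteq> \<alpha> \<and> coef \<beta> \<gamma> > 0"
  proof (rule ccontr)
    assume "\<not> ?thesis"
    hence z: "\<And>\<beta>. \<beta> \<in> S \<Longrightarrow> \<beta> \<noteq> \<alpha> \<Longrightarrow> coef \<beta> \<gamma> = 0" using pos_coef_nonneg[OF g] by force
    have e: "\<gamma> = coef \<alpha> \<gamma> *\<^sub>R \<alpha>" by (rule vec_eqI) (use z a in \<open>auto simp: coef_simple\<close>)
    hence "coef \<alpha> \<gamma> = 1 \<or> coef \<alpha> \<gamma> = -1"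
      using reduced g a pos_root[of \<gamma>] simple_root[of \<alpha>] unfolding reduced_roots_def by metis
    hence "\<gamma> = \<alpha> \<or> \<gamma> = - \<alpha>" using e by (metis scaleR_minus_left scaleR_one)
    thus False using ne pos_not_neg[of \<alpha>] simple_pos[OF a] g by auto
  qed
  then obtain \<beta> where "\<beta> \<in> S" "\<beta> \<noteq> \<alpha>" "coef \<beta> \<gamma> > 0" by blast
  thus ?thesis using r pos_iff_coef_pos a by (force simp: coef_simple)
qed

text \<open>A positive product would make the difference a root with coordinates of both
  signs.\<close>

lemma simple_inner_nonpos:
  assumes "\<alpha> \<in> S" "\<beta> \<in> S" "\<alpha> \<noteq> \<beta>"
  shows "\<alpha> \<bullet> \<beta> \<le> 0"
proof (rule ccontr)
  assume "\<not> ?thesis"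
  hence r: "\<alpha> - \<beta> \<in> \<Phi>" using root_diff assms simple_root by auto
  from r have "\<alpha> - \<beta> \<in> P" using pos_iff_coef_pos assms(1,2) \<open>\<alpha> \<noteq> \<beta>\<close> by (force simp: coef_simple)
  moreover have "\<beta> - \<alpha> \<in> P" using r pos_iff_coef_pos[of "\<beta> - \<alpha>"] diff_root_swap[of \<alpha> \<beta>] assms
    by (force simp: coef_simple)
  ultimately show False using pos_not_neg[of "\<alpha> - \<beta>"] by simp
qed

text \<open>A positive sum has a positive term. Applied to a root or a difference of roots, this
  finds the simple root to subtract, add or reflect in.\<close>

lemma inner_pos_simple:
  assumes "x \<bullet> x' > 0" "\<And>\<alpha>. \<alpha> \<in> S \<Longrightarrow> coef \<alpha> x \<ge> 0"
  shows "\<exists>\<alpha>\<in>S. coef \<alpha> x > 0 \<and> \<alpha> \<bullet> x' > 0"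
proof (rule ccontr)
  assume c: "\<not> ?thesis"
  have "x \<bullet> x' \<le> 0" unfolding inner_expand[of x x']
    by (rule sum_nonpos) (metis assms(2) c linorder_not_less mult_nonneg_nonpos mult_zero_left order_less_le)
  thus False using assms by simp
qed

section \<open>Heights and the coordinatewise order\<close>

definition height :: "'a \<Rightarrow> real" where
  "height v = (\<Sum>\<alpha>\<in>S. coef \<alpha> v)"

lemma height_add [simp]: "height (x + y) = height x + height y"
  and height_diff [simp]: "height (x - y) = height x - height y"
  and height_scale [simp]: "height (c *\<^sub>R x) = c * height x"
  by (simp_all add: height_def sum.distrib sum_subtractf sum_distrib_left)

lemma height_simple: "\<alpha> \<in> S \<Longrightarrow> height \<alpha> = 1"
  using finite_S by (simp add: height_def coef_simple)

lemma height_Nats: "(\<And>\<alpha>. \<alpha> \<in> S \<Longrightarrow> coef \<alpha> v \<in> \<nat>) \<Longrightarrow> height v \<in> \<nat>"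
  unfolding height_def by (rule sum_in_Nats)

lemma height_pos: "\<gamma> \<in> P \<Longrightarrow> height \<gamma> > 0"
  unfolding height_def using pos_iff_coef_pos[of \<gamma>] pos_root finite_S pos_coef_nonneg
  by (auto intro: sum_pos2)

text \<open>On positive roots this is the root order (\<open>root_le_iff\<close>), but it asks for
  no chain of intermediate roots and applies to arbitrary vectors.\<close>

definition coef_le :: "'a \<Rightarrow> 'a \<Rightarrow> bool" where
  "coef_le x y \<longleftrightarrow> (\<forall>\<alpha>\<in>S. coef \<alpha> x \<le> coef \<alpha> y)"

lemma coef_le_antisym: "coef_le x y \<Longrightarrow> coef_le y x \<Longrightarrow> x = y"
  unfolding coef_le_def by (intro vec_eqI) force

lemma coef_le_trans: "coef_le x y \<Longrightarrow> coef_le y z \<Longrightarrow> coef_le x z"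
  unfolding coef_le_def by force

lemma coef_le_height: "coef_le x y \<Longrightarrow> height x \<le> height y"
  unfolding coef_le_def height_def by (auto intro: sum_mono)

text \<open>Height is strictly increasing, so a root of extreme height is extremal in the
  order.\<close>

lemma coef_le_height_eq: "coef_le x y \<Longrightarrow> height y \<le> height x \<Longrightarrow> x = y"
proof (rule ccontr)
  assume le: "coef_le x y" "height y \<le> height x" "x \<noteq> y"
  then obtain \<alpha> where "\<alpha> \<in> S" "coef \<alpha> x \<noteq> coef \<alpha> y" using vec_eqI by blast
  hence "height x < height y" unfolding height_def using le(1) finite_S
    by (intro sum_strict_mono_ex1) (auto simp: coef_le_def order_less_le intro!: bexI[of _ \<alpha>])
  thus False using le by simp
qed

lemma coef_le_add_pos: "\<gamma> \<in> P \<Longrightarrow> coef_le x (x + \<gamma>)"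
  by (simp add: coef_le_def pos_coef_nonneg)

lemma root_le_imp_coef_le: "root_le \<Phi> S \<gamma> \<nu> \<Longrightarrow> coef_le \<gamma> \<nu>"
  unfolding root_le_def
proof (induction rule: rtranclp_induct)
  case base
  show ?case by (simp add: coef_le_def)
next
  case (step y z)
  have "coef_le y (y + (z - y))"
    using step(2) simple_pos coef_le_add_pos unfolding root_covers_def by blast
  thus ?case using step coef_le_trans by auto
qed

text \<open>Since \<open>(\<nu> - \<gamma>, \<nu> - \<gamma>) > 0\<close>, some simple root \<open>\<alpha>\<close> of the support of \<open>\<nu> - \<gamma>\<close> can be
  subtracted from \<open>\<nu>\<close> or added to \<open>\<gamma>\<close>.\<close>

lemma coef_le_imp_root_le:
  assumes "\<gamma> \<in> P" "\<nu> \<in> P" "coef_le \<gamma> \<nu>"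
  shows "root_le \<Phi> S \<gamma> \<nu>"
proof -
  have "height (\<nu> - \<gamma>) = real n \<Longrightarrow> ?thesis" for n
    using assms
  proof (induction n arbitrary: \<gamma> \<nu> rule: less_induct)
    case (less n)
    note g = less.prems(2) and n = less.prems(3) and le = less.prems(4)
    have nn: "coef \<alpha> (\<nu> - \<gamma>) \<ge> 0" if "\<alpha> \<in> S" for \<alpha> using le that by (simp add: coef_le_def)
    have int: "coef \<alpha> x \<in> \<int>" if "x \<in> P" "\<alpha> \<in> S" for x \<alpha>
      using pos_coef_Nats[OF that] Nats_subset_Ints by auto
    show ?case
    proof (cases "\<gamma> = \<nu>")
      case True
      thus ?thesis by (simp add: root_le_def)
    next
      case False
      hence "(\<nu> - \<gamma>) \<bullet> (\<nu> - \<gamma>) > 0" by simp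
      then obtain \<alpha> where a: "\<alpha> \<in> S" "coef \<alpha> (\<nu> - \<gamma>) > 0" "\<alpha> \<bullet> (\<nu> - \<gamma>) > 0"
        using inner_pos_simple nn by blast
      have "coef \<alpha> (\<nu> - \<gamma>) \<in> \<int>" using int[OF n a(1)] int[OF g a(1)] by simp
      then obtain k where "coef \<alpha> (\<nu> - \<gamma>) = of_int k" by (auto elim: Ints_cases)
      \<comment> \<open>Being positive and integral, the difference is at least 1, so there is room
        for one \<open>\<alpha>\<close> between \<open>\<gamma>\<close> and
        \<open>\<nu>\<close>.\<close>
      hence c1: "coef \<alpha> \<gamma> + 1 \<le> coef \<alpha> \<nu>" using a(2) by simp
      have hn: "n > 0" "height (\<nu> - \<gamma> - \<alpha>) = real (n - 1)"
      proof -
        have "coef_le \<alpha> (\<nu> - \<gamma>)" using c1 nn by (auto simp: coef_le_def coef_simple[OF a(1)])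
        from coef_le_height[OF this] show "n > 0" using less.prems(1) a(1) height_simple by auto
        thus "height (\<nu> - \<gamma> - \<alpha>) = real (n - 1)" using less.prems(1) a(1) by (simp add: height_simple of_nat_diff)
      qed
      from a(3) consider "\<alpha> \<bullet> \<nu> > 0" | "\<alpha> \<bullet> \<gamma> < 0" by (force simp: inner_diff)
      thus ?thesis
      proof cases
        case 1
        have le': "coef_le \<gamma> (\<nu> - \<alpha>)" using c1 le by (auto simp: coef_le_def coef_simple[OF a(1)])
        \<comment> \<open>Otherwise \<open>\<gamma>\<close> would lie below 0 and its height would
          not be positive.\<close>
        have "\<nu> \<noteq> \<alpha>"
          using coef_le_height[OF le'] height_pos[OF g] by (auto simp: height_def)
        hence r: "\<nu> - \<alpha> \<in> \<Phi>" using root_diff[of \<nu> \<alpha>] 1 n a(1) pos_root simple_root by (simp add: inner_commute)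
        hence p: "\<nu> - \<alpha> \<in> P" using pos_coef_geI[OF g] le' by (simp add: coef_le_def)
        have "root_le \<Phi> S \<gamma> (\<nu> - \<alpha>)"
          by (rule less.IH[of "n - 1"]) (use hn g p le' in \<open>auto simp: algebra_simps\<close>)
        moreover have "root_covers \<Phi> S \<nu> (\<nu> - \<alpha>)" using n p a by (simp add: root_covers_def)
        ultimately show ?thesis unfolding root_le_def by (meson rtranclp.rtrancl_into_rtrancl)
      next
        case 2
        have "\<gamma> \<noteq> - \<alpha>" using pos_not_neg[of \<alpha>] simple_pos[OF a(1)] g by auto
        hence r: "\<gamma> + \<alpha> \<in> \<Phi>" using root_add[of \<gamma> \<alpha>] 2 g a(1) pos_root simple_root by (simp add: inner_commute)
        hence p: "\<gamma> + \<alpha> \<in> P" using pos_add g simple_pos a(1) by blast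
        have le': "coef_le (\<gamma> + \<alpha>) \<nu>" using c1 le by (auto simp: coef_le_def coef_simple[OF a(1)])
        have "root_le \<Phi> S (\<gamma> + \<alpha>) \<nu>"
          by (rule less.IH[of "n - 1"]) (use hn n p le' in \<open>auto simp: algebra_simps\<close>)
        moreover have "root_covers \<Phi> S (\<gamma> + \<alpha>) \<gamma>" using g p a by (simp add: root_covers_def)
        ultimately show ?thesis unfolding root_le_def by (meson converse_rtranclp_into_rtranclp)
      qed
    qed
  qed
  moreover have "height (\<nu> - \<gamma>) \<in> \<nat>"
  proof (rule height_Nats)
    fix \<alpha> assume a: "\<alpha> \<in> S"
    have "coef \<alpha> \<nu> - coef \<alpha> \<gamma> \<in> \<int>"
      using pos_coef_Nats[OF assms(1) a] pos_coef_Nats[OF assms(2) a] Nats_subset_Ints by (auto intro: Ints_diff)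
    moreover have "coef \<alpha> \<nu> - coef \<alpha> \<gamma> \<ge> 0" using assms(3) a by (simp add: coef_le_def)
    ultimately show "coef \<alpha> (\<nu> - \<gamma>) \<in> \<nat>" by (simp add: Nats_altdef2)
  qed
  ultimately show ?thesis by (auto elim: Nats_cases)
qed

lemma root_le_iff: "\<gamma> \<in> P \<Longrightarrow> \<nu> \<in> P \<Longrightarrow> root_le \<Phi> S \<gamma> \<nu> \<longleftrightarrow> coef_le \<gamma> \<nu>"
  using root_le_imp_coef_le coef_le_imp_root_le by blast

subsection \<open>The highest root\<close>

text \<open>The Dynkin diagram is connected: if \<open>T\<close> were orthogonal to its complement
  in \<open>S\<close>, every root would lie in the span of one of the two, which splits
  \<open>\<Phi>\<close>.\<close>

lemma simple_irreducible:
  assumes T: "T \<subseteq> S" "T \<noteq> {}" "T \<noteq> S"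
  shows "\<exists>\<alpha>\<in>T. \<exists>\<beta>\<in>S - T. \<alpha> \<bullet> \<beta> \<noteq> 0"
proof (rule ccontr)
  assume "\<not> ?thesis"
  hence o: "\<And>\<alpha> \<beta>. \<alpha> \<in> T \<Longrightarrow> \<beta> \<in> S - T \<Longrightarrow> \<alpha> \<bullet> \<beta> = 0" by blast
  have orth_span: "x \<bullet> y = 0" if "x \<in> span T" "y \<in> span (S - T)" for x y
  proof -
    have "orthogonal x b" if "b \<in> S - T" for b
      using orthogonal_to_span[of x T b] \<open>x \<in> span T\<close> o that
      by (auto simp: orthogonal_def inner_commute)
    thus ?thesis using orthogonal_to_span[of y "S - T" x] \<open>y \<in> span (S - T)\<close> by (auto simp: orthogonal_def)
  qed
  \<comment> \<open>In the span of \<open>S - U\<close> the reflected root would be orthogonal to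
    \<open>\<alpha>\<close>, but reflection only negates the nonzero product. \<open>U\<close> is
    generic so as to serve for both \<open>T\<close> and \<open>S - T\<close>.\<close>
  have step: "x \<in> span U"
    if U: "U \<subseteq> S" "\<And>x y. x \<in> span U \<Longrightarrow> y \<in> span (S - U) \<Longrightarrow> x \<bullet> y = 0"
      and a: "\<alpha> \<in> U" and x: "x \<bullet> \<alpha> \<noteq> 0" "x \<in> \<Phi>"
      and s: "x - cartan x \<alpha> *\<^sub>R \<alpha> \<in> span U \<or> x - cartan x \<alpha> *\<^sub>R \<alpha> \<in> span (S - U)" for U \<alpha> x
  proof -
    have aS: "\<alpha> \<in> \<Phi>" using U(1) a simple_root by blast
    have "(x - cartan x \<alpha> *\<^sub>R \<alpha>) \<bullet> \<alpha> = - (x \<bullet> \<alpha>)"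
      using root_norm_pos[OF aS] by (simp add: inner_diff cartan_def)
    hence "x - cartan x \<alpha> *\<^sub>R \<alpha> \<notin> span (S - U)"
      using U(2)[of \<alpha> "x - cartan x \<alpha> *\<^sub>R \<alpha>"] a x span_base[of \<alpha> U] by (auto simp: inner_commute)
    hence "x - cartan x \<alpha> *\<^sub>R \<alpha> + cartan x \<alpha> *\<^sub>R \<alpha> \<in> span U" using s a span_base span_scale span_add by blast
    thus ?thesis by simp
  qed
  \<comment> \<open>Reflecting in a simple root with positive product lowers the height, which
    drives the induction.\<close>
  have pos: "\<gamma> \<in> span T \<or> \<gamma> \<in> span (S - T)" if "height \<gamma> = real n" "\<gamma> \<in> P" for n \<gamma>
    using that
  proof (induction n arbitrary: \<gamma> rule: less_induct)
    case (less n)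
    have "\<gamma> \<bullet> \<gamma> > 0" using root_norm_pos pos_root less.prems by blast
    then obtain \<alpha> where a: "\<alpha> \<in> S" "\<alpha> \<bullet> \<gamma> > 0"
      using inner_pos_simple[of \<gamma> \<gamma>] pos_coef_nonneg[OF less.prems(2)] by blast
    show ?case
    proof (cases "\<gamma> = \<alpha>")
      case True
      thus ?thesis using a span_base[of \<alpha> T] span_base[of \<alpha> "S - T"] by auto
    next
      case False
      let ?x = "\<gamma> - cartan \<gamma> \<alpha> *\<^sub>R \<alpha>"
      have xP: "?x \<in> P" using reflect_simple_pos less.prems(2) a(1) False by blast
      obtain m where m: "height ?x = real m"
        using height_Nats[of ?x] pos_coef_Nats[OF xP] by (auto elim: Nats_cases)
      have "cartan \<gamma> \<alpha> \<ge> 1" using cartan_pos_ge_1 a less.prems(2) pos_root simple_root by (simp add: inner_commute)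
      hence "m < n" using m less.prems(1) a(1) by (auto simp: height_simple)
      hence ih: "?x \<in> span T \<or> ?x \<in> span (S - T)" using less.IH m xP by blast
      have TT: "S - (S - T) = T" using T(1) by blast
      show ?thesis
      proof (cases "\<alpha> \<in> T")
        case True
        have "\<gamma> \<in> span T"
          by (rule step[of T \<alpha>]) (use T(1) True a ih orth_span less.prems(2) pos_root in \<open>auto simp: inner_commute\<close>)
        thus ?thesis ..
      next
        case False
        have "\<gamma> \<in> span (S - T)"
        proof (rule step[of "S - T" \<alpha>])
          fix x y assume "x \<in> span (S - T)" "y \<in> span (S - (S - T))"
          thus "x \<bullet> y = 0" using orth_span[of y x] TT by (simp add: inner_commute)
        qed (use False a ih TT less.prems(2) pos_root in \<open>auto simp: inner_commute\<close>)
        thus ?thesis ..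
      qed
    qed
  qed
  have all: "\<gamma> \<in> span T \<or> \<gamma> \<in> span (S - T)" if "\<gamma> \<in> \<Phi>" for \<gamma>
  proof -
    have "x \<in> span T \<or> x \<in> span (S - T)" if "x \<in> P" for x
      using pos[of x] height_Nats[of x] pos_coef_Nats[of x] that by (auto elim: Nats_cases)
    thus ?thesis using pos_or_neg[OF that] span_neg[of "- \<gamma>"] by fastforce
  qed
  let ?A = "\<Phi> \<inter> span T" and ?B = "\<Phi> \<inter> span (S - T)"
  obtain \<alpha> \<beta> where "\<alpha> \<in> T" "\<beta> \<in> S - T" using T by blast
  hence "\<alpha> \<in> ?A" "\<beta> \<in> ?B"
    using T(1) simple_root span_base[of \<alpha> T] span_base[of \<beta> "S - T"] by auto
  moreover have "?A \<union> ?B = \<Phi>" using all by blast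
  moreover have "?A \<inter> ?B = {}"
  proof -
    have "x \<bullet> x = 0" if "x \<in> ?A \<inter> ?B" for x using that orth_span by blast
    thus ?thesis using root_norm_pos by fastforce
  qed
  moreover have "\<forall>\<alpha>\<in>?A. \<forall>\<beta>\<in>?B. \<alpha> \<bullet> \<beta> = 0" using orth_span by blast
  ultimately show False using irreducible unfolding irreducible_roots_def by (metis empty_iff)
qed

text \<open>A negative product would make \<open>t + \<alpha>\<close> a larger positive
  root.\<close>

lemma maximal_dominant:
  assumes t: "t \<in> P" and max: "\<And>\<gamma>. \<gamma> \<in> P \<Longrightarrow> coef_le t \<gamma> \<Longrightarrow> \<gamma> = t" and a: "\<alpha> \<in> S"
  shows "t \<bullet> \<alpha> \<ge> 0"
proof (rule ccontr)
  assume "\<not> ?thesis"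
  moreover have "t \<noteq> - \<alpha>" using pos_not_neg[of \<alpha>] simple_pos[OF a] t by auto
  ultimately have "t + \<alpha> \<in> \<Phi>" using root_add t a pos_root simple_root by auto
  hence "t + \<alpha> \<in> P" using pos_add t simple_pos a by blast
  hence "t + \<alpha> = t" using max coef_le_add_pos simple_pos a by blast
  thus False using a simple_root zero_not_root by auto
qed

text \<open>Were the support proper, connectedness would give a simple \<open>y\<close> outside it
  joined to some \<open>x\<close> inside. All terms of \<open>t \<bullet> y\<close> are then
  nonpositive and the one for \<open>x\<close> is negative, against dominance.\<close>

lemma maximal_full_support:
  assumes t: "t \<in> P" and max: "\<And>\<gamma>. \<gamma> \<in> P \<Longrightarrow> coef_le t \<gamma> \<Longrightarrow> \<gamma> = t" and a: "\<alpha> \<in> S"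
  shows "coef \<alpha> t > 0"
proof -
  let ?T = "{\<alpha>\<in>S. coef \<alpha> t > 0}"
  have "?T = S"
  proof (rule ccontr)
    assume "?T \<noteq> S"
    moreover have "?T \<noteq> {}" using pos_iff_coef_pos t pos_root by auto
    ultimately obtain x y where xy: "x \<in> ?T" "y \<in> S - ?T" "x \<bullet> y \<noteq> 0"
      using simple_irreducible[of ?T] by auto
    have "coef y t = 0" using xy pos_coef_nonneg[OF t, of y] by auto
    have "x \<noteq> y" using xy by auto
    hence neg: "x \<bullet> y < 0" using simple_inner_nonpos[of x y] xy by auto
    have "t \<bullet> y < 0" unfolding inner_expand[of t y]
    proof (subst sum.remove[OF finite_S, of x])
      show "x \<in> S" using xy by simp
      have "(\<Sum>z\<in>S - {x}. coef z t * (z \<bullet> y)) \<le> 0"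
      proof (rule sum_nonpos)
        fix z assume z: "z \<in> S - {x}"
        show "coef z t * (z \<bullet> y) \<le> 0"
        proof (cases "z = y")
          case True
          thus ?thesis using \<open>coef y t = 0\<close> by simp
        next
          case False
          thus ?thesis using simple_inner_nonpos[of z y] pos_coef_nonneg[OF t, of z] z xy
            by (simp add: mult_nonneg_nonpos)
        qed
      qed
      moreover have "coef x t * (x \<bullet> y) < 0" using xy neg by (simp add: mult_pos_neg)
      ultimately show "coef x t * (x \<bullet> y) + (\<Sum>z\<in>S - {x}. coef z t * (z \<bullet> y)) < 0" by linarith
    qed
    thus False using maximal_dominant[OF t max, of y] xy by auto
  qed
  thus ?thesis using a by blast
qed

text \<open>Full support of \<open>t\<close> and dominance of \<open>t'\<close> give a positive
  product, so \<open>t - t'\<close> is a root and one of the two lies above the other.\<close>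

lemma maximal_unique:
  assumes t: "t \<in> P" and max: "\<And>\<gamma>. \<gamma> \<in> P \<Longrightarrow> coef_le t \<gamma> \<Longrightarrow> \<gamma> = t"
    and t': "t' \<in> P" and max': "\<And>\<gamma>. \<gamma> \<in> P \<Longrightarrow> coef_le t' \<gamma> \<Longrightarrow> \<gamma> = t'"
  shows "t = t'"
proof (rule ccontr)
  assume ne: "t \<noteq> t'"
  have dom: "\<And>\<alpha>. \<alpha> \<in> S \<Longrightarrow> t' \<bullet> \<alpha> \<ge> 0" using maximal_dominant[OF t' max'] by blast
  have "t' \<bullet> t' > 0" using t' pos_root root_norm_pos by blast
  then obtain \<alpha> where a: "\<alpha> \<in> S" "\<alpha> \<bullet> t' > 0"
    using inner_pos_simple[of t' t'] pos_coef_nonneg[OF t'] by blast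
  have "t \<bullet> t' > 0" unfolding inner_expand[of t t']
  proof (rule sum_pos2[OF finite_S a(1)])
    show "0 < coef \<alpha> t * (\<alpha> \<bullet> t')" using maximal_full_support[OF t max a(1)] a(2) by simp
    show "0 \<le> coef i t * (i \<bullet> t')" if "i \<in> S" for i
      using pos_coef_nonneg[OF t that] dom[OF that] by (simp add: inner_commute)
  qed
  hence "t - t' \<in> \<Phi>" using root_diff t t' pos_root ne by blast
  then consider "t - t' \<in> P" | "t' - t \<in> P" using pos_or_neg[of "t - t'"] by auto
  thus False
  proof cases
    case 1
    thus False using max'[OF t] coef_le_add_pos[OF 1, of t'] ne by simp
  next
    case 2
    thus False using max[OF t'] coef_le_add_pos[OF 2, of t] ne by simp
  qed
qed

lemma finite_P: "finite P"
  using finite_roots by (simp add: pos_roots_def)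

lemma maximal_above:
  assumes g: "\<gamma> \<in> P"
  shows "\<exists>t\<in>P. coef_le \<gamma> t \<and> (\<forall>\<nu>\<in>P. coef_le t \<nu> \<longrightarrow> \<nu> = t)"
proof -
  let ?U = "{\<nu>\<in>P. coef_le \<gamma> \<nu>}"
  have fin: "finite ?U" using finite_P by simp
  have "\<gamma> \<in> ?U" using g by (simp add: coef_le_def)
  then obtain t where "t \<in> ?U" "Max (height ` ?U) = height t"
    using obtains_MAX[OF fin, of height] by auto
  hence t: "t \<in> ?U" "\<And>\<nu>. \<nu> \<in> ?U \<Longrightarrow> height \<nu> \<le> height t"
    using fin Max_ge[of "height ` ?U"] by auto
  moreover have "\<nu> = t" if n: "\<nu> \<in> P" "coef_le t \<nu>" for \<nu>
  proof -
    have "\<nu> \<in> ?U" using n t coef_le_trans by blast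
    thus ?thesis using t(2) coef_le_height_eq[OF n(2)] by blast
  qed
  ultimately show ?thesis by blast
qed

abbreviation \<theta> :: 'a where "\<theta> \<equiv> highest_root \<Phi> S"

lemma roots_nonempty: "P \<noteq> {}"
  using irreducible pos_or_neg unfolding irreducible_roots_def by blast

text \<open>Every positive root lies below a maximal one, and maximal roots coincide, so the
  description in \<open>highest_root\<close> is met exactly once.\<close>

lemma highest_root_spec: "\<theta> \<in> P \<and> (\<forall>\<gamma>\<in>P. root_le \<Phi> S \<gamma> \<theta>)"
proof -
  obtain g where "g \<in> P" using roots_nonempty by blast
  then obtain t where t: "t \<in> P" "\<And>\<nu>. \<nu> \<in> P \<Longrightarrow> coef_le t \<nu> \<Longrightarrow> \<nu> = t"
    using maximal_above by blast
  have "coef_le \<gamma> t" if "\<gamma> \<in> P" for \<gamma>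
    using maximal_above[OF that] maximal_unique[OF t] by metis
  hence top: "\<forall>\<gamma>\<in>P. root_le \<Phi> S \<gamma> t" using root_le_iff t(1) by blast
  show ?thesis unfolding highest_root_def
  proof (rule theI[of _ t])
    show "t \<in> P \<and> (\<forall>\<gamma>\<in>P. root_le \<Phi> S \<gamma> t)" using t top by blast
    fix u assume "u \<in> P \<and> (\<forall>\<gamma>\<in>P. root_le \<Phi> S \<gamma> u)"
    thus "u = t" using t top root_le_iff coef_le_antisym by blast
  qed
qed

lemma highest_pos: "\<theta> \<in> P" and highest_root: "\<theta> \<in> \<Phi>"
  using highest_root_spec pos_root by auto

lemma coef_le_highest: "\<gamma> \<in> P \<Longrightarrow> coef_le \<gamma> \<theta>"
  using highest_root_spec root_le_iff by blast

lemma highest_dominant: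
  assumes "\<gamma> \<in> P"
  shows "\<gamma> \<bullet> \<theta> \<ge> 0"
proof -
  have "\<alpha> \<bullet> \<theta> \<ge> 0" if "\<alpha> \<in> S" for \<alpha>
    using maximal_dominant[OF highest_pos _ that] coef_le_highest coef_le_antisym by (metis inner_commute)
  thus ?thesis unfolding inner_expand[of \<gamma>] by (intro sum_nonneg) (simp add: pos_coef_nonneg assms)
qed

text \<open>If \<open>p = \<langle>\<gamma>, \<theta>\<^sup>\<or>\<rangle> \<ge> 2\<close> and \<open>\<gamma> \<noteq> \<theta>\<close>, then the root \<open>p\<theta> - \<gamma>\<close> would lie strictly above \<open>\<theta>\<close>.\<close>

lemma cartan_highest_le_1:
  assumes g: "\<gamma> \<in> P" "\<gamma> \<noteq> \<theta>"
  shows "cartan \<gamma> \<theta> \<le> 1"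
proof (rule ccontr)
  let ?p = "cartan \<gamma> \<theta>"
  assume "\<not> ?p \<le> 1"
  moreover obtain k where "?p = of_int k" using cartan_Ints[OF highest_root pos_root[OF g(1)]] by (rule Ints_cases)
  ultimately have p: "?p \<ge> 2" by simp
  have "\<gamma> - ?p *\<^sub>R \<theta> \<in> \<Phi>" using reflect_root highest_root pos_root g(1) by blast
  hence r: "?p *\<^sub>R \<theta> - \<gamma> \<in> \<Phi>" using diff_root_swap by blast
  \<comment> \<open>The implication keeps the case of equality, which later yields
    \<open>\<gamma> = \<theta>\<close>.\<close>
  have ge: "coef \<alpha> \<theta> \<le> coef \<alpha> (?p *\<^sub>R \<theta> - \<gamma>) \<and> (coef \<alpha> (?p *\<^sub>R \<theta> - \<gamma>) \<le> coef \<alpha> \<theta> \<longrightarrow> coef \<alpha> \<gamma> = coef \<alpha> \<theta>)"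
    if "\<alpha> \<in> S" for \<alpha>
  proof -
    have "0 \<le> coef \<alpha> \<theta>" "coef \<alpha> \<gamma> \<le> coef \<alpha> \<theta>"
      using pos_coef_nonneg[OF highest_pos that] coef_le_highest[OF g(1)] that by (auto simp: coef_le_def)
    moreover have "2 * coef \<alpha> \<theta> \<le> ?p * coef \<alpha> \<theta>" using p calculation by (intro mult_right_mono) auto
    ultimately show ?thesis by auto
  qed
  have "?p *\<^sub>R \<theta> - \<gamma> \<in> P" using pos_coef_geI[OF highest_pos r] ge by blast
  hence "coef_le (?p *\<^sub>R \<theta> - \<gamma>) \<theta>" using coef_le_highest by blast
  hence "\<gamma> = \<theta>" using ge by (intro vec_eqI) (auto simp: coef_le_def)
  thus False using g(2) by simp
qed

subsection \<open>Affine roots and the affine Weyl group\<close>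

abbreviation PA :: "'a affine_space set" where "PA \<equiv> pos_affine_roots \<Phi> S"
abbreviation SA :: "'a affine_space set" where "SA \<equiv> simple_affine_roots \<Phi> S"
abbreviation W :: "('a affine_space \<Rightarrow> 'a affine_space) set" where "W \<equiv> affine_weyl \<Phi> S"

lemma pos_affine_iff:
  "(v, k, b) \<in> PA \<longleftrightarrow> b = 0 \<and> v \<in> \<Phi> \<and> k \<in> \<int> \<and> (k > 0 \<or> k = 0 \<and> v \<in> P)"
proof -
  have "(\<exists>n::nat. k = real n \<and> n \<ge> 1) \<longleftrightarrow> k \<in> \<int> \<and> k > 0"
  proof
    assume "k \<in> \<int> \<and> k > 0"
    hence "k \<in> \<nat>" by (simp add: Nats_altdef2)
    then obtain n where "k = real n" by (rule Nats_cases)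
    thus "\<exists>n::nat. k = real n \<and> n \<ge> 1" using \<open>k \<in> \<int> \<and> k > 0\<close> by (intro exI[of _ n]) auto
  qed auto
  moreover have "(v, k, b) \<in> PA \<longleftrightarrow> (b = 0 \<and> k = 0 \<and> v \<in> P) \<or> (b = 0 \<and> v \<in> \<Phi> \<and> (\<exists>n::nat. k = real n \<and> n \<ge> 1))"
    unfolding pos_affine_roots_def emb_def delta_def by auto
  ultimately show ?thesis using pos_root[of v] by auto
qed

lemma simple_affine_iff: "x \<in> SA \<longleftrightarrow> x = (- \<theta>, 1, 0) \<or> (\<exists>\<alpha>\<in>S. x = (\<alpha>, 0, 0))"
  unfolding simple_affine_roots_def emb_def delta_def by auto

text \<open>The real roots in the affine sense, of either sign. The affine Weyl group maps this set
  to itself, so the image of a positive root always has a sign.\<close>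

definition real_roots :: "'a affine_space set" where
  "real_roots = {(v, k, 0) | v k. v \<in> \<Phi> \<and> k \<in> \<int>}"

lemma real_roots_iff: "(v, k, b) \<in> real_roots \<longleftrightarrow> b = 0 \<and> v \<in> \<Phi> \<and> k \<in> \<int>"
  by (auto simp: real_roots_def)

lemma real_root_cases: "x \<in> real_roots \<Longrightarrow> x \<in> PA \<or> - x \<in> PA"
  using pos_or_neg
  by (cases x) (auto simp: real_roots_iff pos_affine_iff uminus_root)

lemma pos_affine_real: "x \<in> PA \<Longrightarrow> x \<in> real_roots"
  by (cases x) (simp add: real_roots_iff pos_affine_iff)

lemma pos_affine_not_neg: "x \<in> PA \<Longrightarrow> - x \<notin> PA"
  using pos_not_neg by (cases x) (auto simp: pos_affine_iff)

lemma simple_affine_pos: "a \<in> SA \<Longrightarrow> a \<in> PA"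
  using highest_root simple_pos simple_root by (auto simp: simple_affine_iff pos_affine_iff uminus_root)

lemma real_root_form_pos: "x \<in> real_roots \<Longrightarrow> aff_form x x > 0"
  using root_norm_pos by (cases x) (auto simp: real_roots_iff)

lemma simple_affine_form: "a \<in> SA \<Longrightarrow> aff_form a a \<noteq> 0"
  using real_root_form_pos[of a] simple_affine_pos pos_affine_real by fastforce

lemma aff_reflection_root:
  "aff_reflection (u, j, 0) (v, k, 0) = (v - cartan v u *\<^sub>R u, k - cartan v u * j, 0)"
  by (simp add: aff_reflection_def cartan_def)

lemma aff_reflection_real:
  assumes "a \<in> real_roots" "x \<in> real_roots"
  shows "aff_reflection a x \<in> real_roots"
proof -
  obtain u j v k where "a = (u, j, 0)" "x = (v, k, 0)" "u \<in> \<Phi>" "j \<in> \<int>" "v \<in> \<Phi>" "k \<in> \<int>"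
    using assms unfolding real_roots_def by blast
  thus ?thesis using reflect_root[of u v] cartan_Ints[of u v]
    by (simp add: aff_reflection_root real_roots_iff)
qed

lemma cartan_minus_right: "cartan x (- y) = - cartan x y"
  and cartan_minus_left: "cartan (- x) y = - cartan x y"
  by (simp_all add: cartan_def)

text \<open>Reflecting in \<open>\<alpha>\<^sub>0\<close> adds \<open>cartan v \<theta>\<close> to
  the level, the coefficient of \<open>\<delta>\<close>. This is nonnegative for positive
  \<open>v\<close> and at least -1 for negative \<open>v\<close> other than
  \<open>- \<theta>\<close>, so only small levels need care.\<close>

lemma aff_reflection_pos:
  assumes a: "a \<in> SA" and x: "x \<in> PA" and ne: "x \<noteq> a"
  shows "aff_reflection a x \<in> PA"
proof -
  obtain v k where xv: "x = (v, k, 0)" and v: "v \<in> \<Phi>" and k: "k \<in> \<int>" "k > 0 \<or> k = 0 \<and> v \<in> P"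
    using x by (cases x) (auto simp: pos_affine_iff)
  have "aff_reflection a x \<in> real_roots"
    using a x simple_affine_pos pos_affine_real aff_reflection_real by blast
  hence r: "fst (aff_reflection a x) \<in> \<Phi>" "fst (snd (aff_reflection a x)) \<in> \<int>"
    by (auto simp: real_roots_def)
  from a consider "a = (- \<theta>, 1, 0)" | \<alpha> where "\<alpha> \<in> S" "a = (\<alpha>, 0, 0)" by (auto simp: simple_affine_iff)
  thus ?thesis
  proof cases
    case 1
    let ?c = "cartan v \<theta>"
    have e: "aff_reflection a x = (v - ?c *\<^sub>R \<theta>, k + ?c, 0)"
      by (simp add: 1 xv aff_reflection_root cartan_minus_right)
    have r': "v - ?c *\<^sub>R \<theta> \<in> \<Phi>" "k + ?c \<in> \<int>" using r e by auto
    show ?thesis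
    proof (cases "v \<in> P")
      case True
      hence "?c \<ge> 0" using highest_dominant[OF True] root_norm_pos[OF highest_root] by (simp add: cartan_def)
      moreover have "k \<ge> 0" using k by auto
      ultimately consider "?c = 0" | "k + ?c > 0" by fastforce
      thus ?thesis
      proof cases
        case 1
        thus ?thesis using e x xv by simp
      next
        case 2
        thus ?thesis using e r' by (simp add: pos_affine_iff)
      qed
    next
      case False
      hence n: "- v \<in> P" using v pos_or_neg by blast
      from False k obtain m where m: "k = of_int m" "m \<ge> 1" by (auto elim!: Ints_cases)
      show ?thesis
      proof (cases "v = - \<theta>")
        case True
        have c: "?c = -2" using True cartan_self[OF highest_root] by (simp add: cartan_minus_left)
        \<comment> \<open>Level 1 is the root \<open>a\<close> itself; level 2 drops to 0, where the
          finite part \<open>\<theta>\<close> is positive.\<close>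
        have "m \<noteq> 1" using ne 1 True xv m by auto
        hence "k + ?c \<ge> 0" using m c by simp
        moreover have "v - ?c *\<^sub>R \<theta> = \<theta>" using True c by (simp add: scaleR_2)
        ultimately show ?thesis using e r' highest_pos by (auto simp: pos_affine_iff)
      next
        case vne: False
        have c: "?c \<ge> -1" using cartan_highest_le_1[OF n] vne
          by (metis cartan_minus_left minus_minus neg_le_iff_le)
        hence "k + ?c \<ge> 0" using m by simp
        \<comment> \<open>Level 0 arises only from \<open>k = 1\<close>, and then
          \<open>v + \<theta>\<close> is positive because \<open>- v\<close> lies below
          \<open>\<theta>\<close> and differs from it.\<close>
        moreover have "v - ?c *\<^sub>R \<theta> \<in> P" if "k + ?c = 0"
        proof (rule ccontr)
          assume np: "v - ?c *\<^sub>R \<theta> \<notin> P"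
          have "?c = -1" using that c m by linarith
          hence "- (v + \<theta>) \<in> P" using np r' pos_or_neg by fastforce
          hence "coef_le \<theta> (- v)" using coef_le_add_pos[of "- (v + \<theta>)" \<theta>] by simp
          hence "- v = \<theta>" using coef_le_highest[OF n] coef_le_antisym by blast
          thus False using vne by (metis minus_minus)
        qed
        ultimately show ?thesis using e r' by (auto simp: pos_affine_iff)
      qed
    qed
  next
    case 2
    have e: "aff_reflection a x = (v - cartan v \<alpha> *\<^sub>R \<alpha>, k, 0)"
      by (simp add: 2 xv aff_reflection_root)
    have "v - cartan v \<alpha> *\<^sub>R \<alpha> \<in> P" if "k = 0"
      using reflect_simple_pos[of v \<alpha>] that k ne 2 xv by auto
    thus ?thesis using e r k by (auto simp: pos_affine_iff)
  qed
qed

text \<open>A positive affine root is a nonnegative combination of simple affine roots, and its form with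
  itself is positive.\<close>

lemma pos_affine_simple_form:
  assumes x: "x \<in> PA"
  shows "\<exists>a\<in>SA. aff_form x a > 0"
proof (rule ccontr)
  assume no: "\<not> ?thesis"
  obtain v k where xv: "x = (v, k, 0)" and v: "v \<in> \<Phi>" and k: "k \<in> \<int>" "k > 0 \<or> k = 0 \<and> v \<in> P"
    using x by (cases x) (auto simp: pos_affine_iff)
  have s: "\<not> \<alpha> \<bullet> v > 0" if "\<alpha> \<in> S" for \<alpha>
  proof -
    have "(\<alpha>, 0, 0) \<in> SA" using that by (simp add: simple_affine_iff)
    thus ?thesis using no xv by (auto simp: inner_commute)
  qed
  have "(- \<theta>, 1, 0) \<in> SA" by (simp add: simple_affine_iff)
  hence t: "\<theta> \<bullet> v \<ge> 0" using no xv by (auto simp: inner_commute)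
  have vv: "v \<bullet> v > 0" using root_norm_pos v by blast
  show False
  proof (cases "v \<in> P")
    case True
    thus False using inner_pos_simple[of v v] vv pos_coef_nonneg s by blast
  next
    case False
    hence n: "- v \<in> P" using v pos_or_neg by blast
    from False k obtain m where m: "k = of_int m" "m \<ge> 1" by (auto elim!: Ints_cases)
    hence k1: "k \<ge> 1" by simp
    \<comment> \<open>In \<open>v + k\<delta> = k\<alpha>\<^sub>0 + (k\<theta> + v)\<close> the
      bracket is the part carried by the finite simple roots.\<close>
    have nn: "coef \<alpha> (k *\<^sub>R \<theta> + v) \<ge> 0" if "\<alpha> \<in> S" for \<alpha>
    proof -
      have "1 * coef \<alpha> \<theta> \<le> k * coef \<alpha> \<theta>"
        using k1 pos_coef_nonneg[OF highest_pos that] by (rule mult_right_mono)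
      thus ?thesis using coef_le_highest[OF n] that by (auto simp: coef_le_def)
    qed
    have "(k *\<^sub>R \<theta> + v) \<bullet> v > 0" using t vv k1 by (simp add: inner_add_left add_nonneg_pos)
    thus False using inner_pos_simple nn s by blast
  qed
qed

section \<open>The action of the affine Weyl group, exchange and inversion sets\<close>

lemma affine_weyl_linear: "w \<in> W \<Longrightarrow> linear w"
  by (induction rule: affine_weyl.induct)
    (rule linear_id linear_compose linear_aff_reflection | assumption)+

lemma affine_weyl_form: "w \<in> W \<Longrightarrow> aff_form (w x) (w y) = aff_form x y"
  by (induction rule: affine_weyl.induct) (simp_all add: aff_reflection_form simple_affine_form)

lemma affine_weyl_real: "w \<in> W \<Longrightarrow> x \<in> real_roots \<Longrightarrow> w x \<in> real_roots"
  by (induction rule: affine_weyl.induct)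
    (simp_all add: aff_reflection_real simple_affine_pos pos_affine_real)

lemma affine_weyl_uminus: "w \<in> W \<Longrightarrow> w (- x) = - w x"
  using affine_weyl_linear linear_neg by blast

lemma simple_reflection_involution: "a \<in> SA \<Longrightarrow> aff_reflection a \<circ> aff_reflection a = id"
  using aff_reflection_involution simple_affine_form by fastforce

lemma affine_weyl_inverse: "w \<in> W \<Longrightarrow> \<exists>w'\<in>W. w' \<circ> w = id \<and> w \<circ> w' = id"
proof (induction rule: affine_weyl.induct)
  case id
  show ?case using affine_weyl.id by (metis comp_id)
next
  case (refl a w)
  then obtain w' where w': "w' \<in> W" "w' \<circ> w = id" "w \<circ> w' = id" by blast
  have s: "aff_reflection a \<in> W" using affine_weyl.refl[OF refl(1) affine_weyl.id] by simp
  have i: "aff_reflection a \<circ> aff_reflection a = id" using simple_reflection_involution refl(1) by blast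
  show ?case
  proof (intro bexI[of _ "w' \<circ> aff_reflection a"] conjI)
    show "w' \<circ> aff_reflection a \<in> W" using affine_weyl_comp w'(1) s by blast
    show "w' \<circ> aff_reflection a \<circ> (aff_reflection a \<circ> w) = id"
      using i w'(2) by (metis comp_assoc comp_id)
    show "aff_reflection a \<circ> w \<circ> (w' \<circ> aff_reflection a) = id"
      using i w'(3) by (metis comp_assoc comp_id)
  qed
qed

lemma affine_weyl_inj: "w \<in> W \<Longrightarrow> inj w"
  using affine_weyl_inverse[of w] by (metis inj_on_id inj_on_imageI2)

text \<open>Letters act from the right. The letter \<open>b\<close> that turns the image of
  \<open>a\<close> negative finds it positive, so this image is \<open>b\<close> itself; conjugation
  moves the reflection in \<open>a\<close> to the left as that in \<open>b\<close>, and the two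
  cancel.\<close>

lemma exchange:
  assumes "set us \<subseteq> SA" "a \<in> SA" "- word us a \<in> PA"
  shows "\<exists>vs. set vs \<subseteq> SA \<and> length vs < length us \<and> word us \<circ> aff_reflection a = word vs"
  using assms(1,3)
proof (induction us)
  case Nil
  thus ?case using simple_affine_pos[OF assms(2)] pos_affine_not_neg by auto
next
  case (Cons b us)
  have b: "b \<in> SA" and us: "set us \<subseteq> SA" using Cons.prems by auto
  hence W: "word us \<in> W" using affine_weyl_word by blast
  show ?case
  proof (cases "- word us a \<in> PA")
    case True
    then obtain vs where "set vs \<subseteq> SA" "length vs < length us" "word us \<circ> aff_reflection a = word vs"
      using Cons.IH us by blast
    moreover from this(3) have "word (b # us) \<circ> aff_reflection a = word (b # vs)"
      by (simp only: word_Cons comp_assoc)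
    ultimately show ?thesis using b by (intro exI[of _ "b # vs"]) (simp del: word_Cons)
  next
    case False
    have "word us a \<in> real_roots"
      using affine_weyl_real[OF W] assms(2) simple_affine_pos pos_affine_real by blast
    hence p: "word us a \<in> PA" using False real_root_cases by blast
    have "word us a = b"
    proof (rule ccontr)
      assume "word us a \<noteq> b"
      hence "aff_reflection b (word us a) \<in> PA" using aff_reflection_pos[OF b p] by simp
      thus False using Cons.prems(2) pos_affine_not_neg by auto
    qed
    hence "word us \<circ> aff_reflection a = aff_reflection b \<circ> word us"
      using aff_reflection_conj[OF affine_weyl_linear[OF W] affine_weyl_form[OF W]] by fastforce
    hence "word (b # us) \<circ> aff_reflection a = word us"
      using simple_reflection_involution[OF b] by (metis comp_assoc id_comp word_Cons)
    thus ?thesis using us by (intro exI[of _ us]) (simp del: word_Cons)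
  qed
qed

text \<open>The last letter is not an inversion of the word, so the preceding letters send it to a
  negative root. Exchange then gives a shorter word for the same element.\<close>

lemma no_inversions_id:
  assumes "set as \<subseteq> SA" "inversions \<Phi> S (word as) = {}"
  shows "word as = id"
  using assms
proof (induction "length as" arbitrary: as rule: less_induct)
  case less
  show ?case
  proof (cases as rule: rev_cases)
    case Nil
    thus ?thesis by simp
  next
    case (snoc us a)
    have us: "set us \<subseteq> SA" "a \<in> SA" using less.prems snoc by auto
    have W: "word as \<in> W" "word us \<in> W" using less.prems us affine_weyl_word by blast+
    have aP: "a \<in> PA" using simple_affine_pos us(2) by blast
    have "- word as a \<notin> PA" using less.prems(2) aP unfolding inversions_def by blast
    hence "word as a \<in> PA"
      using real_root_cases affine_weyl_real[OF W(1)] pos_affine_real[OF aP] by blast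
    moreover have "word as a = - word us a"
      using affine_weyl_uminus[OF W(2)] aff_reflection_self[OF simple_affine_form[OF us(2)]]
      by (simp add: snoc word_append)
    ultimately obtain vs where vs: "set vs \<subseteq> SA" "length vs < length us" "word us \<circ> aff_reflection a = word vs"
      using exchange us by metis
    hence "word as = word vs" by (simp add: snoc word_append)
    thus ?thesis using less.hyps[of vs] vs less.prems(2) snoc by simp
  qed
qed

text \<open>\<open>v\<close> composed with the inverse \<open>w'\<close> of \<open>w\<close> has no
  inversions: \<open>w' x\<close> or its negative is positive, and \<open>w\<close> and
  \<open>v\<close> agree on whether to invert that root.\<close>

lemma inversions_unique:
  assumes w: "w \<in> W" "v \<in> W" and eq: "inversions \<Phi> S w = inversions \<Phi> S v"
  shows "w = v"
proof -
  obtain w' where w': "w' \<in> W" "w' \<circ> w = id" "w \<circ> w' = id" using affine_weyl_inverse w(1) by blast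
  have vw: "v \<circ> w' \<in> W" using affine_weyl_comp w w' by blast
  have "v (w' x) \<in> PA" if x: "x \<in> PA" for x
  proof -
    let ?y = "w' x"
    have wy: "w ?y = x" using w'(3) by (metis comp_apply id_apply)
    have yr: "?y \<in> real_roots" using affine_weyl_real w'(1) x pos_affine_real by blast
    hence vr: "v ?y \<in> real_roots" using affine_weyl_real w(2) by blast
    show ?thesis
    proof (cases "?y \<in> PA")
      case True
      have "?y \<notin> inversions \<Phi> S w" using wy pos_affine_not_neg[OF x] by (simp add: inversions_def)
      thus ?thesis using eq True real_root_cases[OF vr] by (auto simp: inversions_def)
    next
      case False
      hence "- ?y \<in> PA" using yr real_root_cases by blast
      hence "- ?y \<in> inversions \<Phi> S w" using x wy affine_weyl_uminus[OF w(1)] by (simp add: inversions_def)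
      hence "- v (- ?y) \<in> PA" using eq unfolding inversions_def by blast
      thus ?thesis using affine_weyl_uminus[OF w(2)] by simp
    qed
  qed
  hence "inversions \<Phi> S (v \<circ> w') = {}" using pos_affine_not_neg by (auto simp: inversions_def)
  hence "v \<circ> w' = id" using no_inversions_id vw affine_weyl_word by metis
  thus ?thesis using w'(2) by (metis comp_assoc comp_id id_comp)
qed

text \<open>Among roots, the reflection in the simple root \<open>w x\<close> changes the sign of
  \<open>w x\<close> and its negative only, so no other positive root enters or leaves the
  set.\<close>

lemma inversions_reflection:
  assumes w: "w \<in> W" and x: "x \<in> PA" and a: "w x \<in> SA"
  shows "inversions \<Phi> S (aff_reflection (w x) \<circ> w) = insert x (inversions \<Phi> S w)"
proof -
  let ?s = "aff_reflection (w x)"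
  have neg: "?s (- z) = - ?s z" for z using linear_neg[OF linear_aff_reflection] .
  have "- ?s (w y) \<in> PA \<longleftrightarrow> - w y \<in> PA" if y: "y \<in> PA" "y \<noteq> x" for y
  proof -
    have ne: "w y \<noteq> w x" using affine_weyl_inj[OF w] y(2) by (auto dest: injD)
    have ne': "- w y \<noteq> w x"
    proof
      assume "- w y = w x"
      hence "- y = x" using affine_weyl_inj[OF w] affine_weyl_uminus[OF w] by (metis injD)
      thus False using x y pos_affine_not_neg by blast
    qed
    have "w y \<in> real_roots" using affine_weyl_real w y pos_affine_real by blast
    then consider "w y \<in> PA" | "- w y \<in> PA" using real_root_cases by blast
    thus ?thesis
    proof cases
      case 1
      thus ?thesis using aff_reflection_pos[OF a 1 ne] pos_affine_not_neg by blast
    next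
      case 2
      thus ?thesis using aff_reflection_pos[OF a 2 ne'] neg by simp
    qed
  qed
  moreover have "- ?s (w x) \<in> PA"
    using aff_reflection_self[OF simple_affine_form[OF a]] simple_affine_pos[OF a] by simp
  ultimately show ?thesis using x by (auto simp: inversions_def)
qed

subsection \<open>Abelian ideals\<close>

abbreviation Ab :: "'a set set" where "Ab \<equiv> abelian_ideals \<Phi> S"

lemma abelian_ideal_iff:
  "I \<in> Ab \<longleftrightarrow> I \<subseteq> P \<and> (\<forall>\<gamma>\<in>I. \<forall>\<nu>\<in>P. coef_le \<gamma> \<nu> \<longrightarrow> \<nu> \<in> I) \<and> (\<forall>\<gamma>\<in>I. \<forall>\<nu>\<in>I. \<gamma> + \<nu> \<notin> \<Phi>)"
proof (cases "I \<subseteq> P")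
  case True
  have "root_le \<Phi> S \<gamma> \<nu> \<longleftrightarrow> coef_le \<gamma> \<nu>" if "\<gamma> \<in> I" "\<nu> \<in> P" for \<gamma> \<nu>
    using True root_le_iff that by blast
  moreover have "\<gamma> + \<nu> \<in> P \<longleftrightarrow> \<gamma> + \<nu> \<in> \<Phi>" if "\<gamma> \<in> I" "\<nu> \<in> I" for \<gamma> \<nu>
    using True that pos_add[of \<gamma> \<nu>] pos_root[of "\<gamma> + \<nu>"] by blast
  ultimately show ?thesis unfolding abelian_ideals_def upper_ideal_def by simp
qed (simp add: abelian_ideals_def upper_ideal_def)

lemma abelian_pos: "I \<in> Ab \<Longrightarrow> \<gamma> \<in> I \<Longrightarrow> \<gamma> \<in> P"
  and abelian_upper: "I \<in> Ab \<Longrightarrow> \<gamma> \<in> I \<Longrightarrow> \<nu> \<in> P \<Longrightarrow> coef_le \<gamma> \<nu> \<Longrightarrow> \<nu> \<in> I"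
  and abelian_sum: "I \<in> Ab \<Longrightarrow> \<gamma> \<in> I \<Longrightarrow> \<nu> \<in> I \<Longrightarrow> \<gamma> + \<nu> \<notin> \<Phi>"
  unfolding abelian_ideal_iff by blast+

lemma finite_abelian: "I \<in> Ab \<Longrightarrow> finite I"
  unfolding abelian_ideal_iff using finite_P finite_subset by blast

text \<open>A root of greatest height in \<open>J - I\<close> works: whatever lies strictly above it
  is already in \<open>I\<close>. Hence covers add a single root.\<close>

lemma abelian_insert:
  assumes I: "I \<in> Ab" and J: "J \<in> Ab" and IJ: "I \<subset> J"
  shows "\<exists>\<gamma>\<in>J - I. insert \<gamma> I \<in> Ab"
proof -
  have fin: "finite (J - I)" using finite_abelian J by blast
  moreover have "J - I \<noteq> {}" using IJ by blast
  ultimately obtain \<gamma> where g: "\<gamma> \<in> J - I" "Max (height ` (J - I)) = height \<gamma>"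
    using obtains_MAX[of "J - I" height] by auto
  hence max: "height \<nu> \<le> height \<gamma>" if "\<nu> \<in> J - I" for \<nu>
    using that fin Max_ge[of "height ` (J - I)"] by auto
  have sub: "insert \<gamma> I \<subseteq> J" using g(1) IJ by blast
  have "\<nu> \<in> insert \<gamma> I" if "\<beta> \<in> insert \<gamma> I" "\<nu> \<in> P" "coef_le \<beta> \<nu>" for \<beta> \<nu>
  proof (cases "\<beta> \<in> I")
    case True
    thus ?thesis using abelian_upper[OF I] that by blast
  next
    case False
    hence "coef_le \<gamma> \<nu>" using that by auto
    moreover have "\<nu> \<in> J" using abelian_upper[OF J] that sub by blast
    ultimately show ?thesis using max[of \<nu>] coef_le_height_eq by blast
  qed
  hence "insert \<gamma> I \<in> Ab"
    unfolding abelian_ideal_iff using sub abelian_pos[OF J] abelian_sum[OF J] by blast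
  thus ?thesis using g(1) by blast
qed

text \<open>A root of least height lies above no other root of \<open>I\<close>. Its removal drives
  the induction on the size of an ideal.\<close>

lemma abelian_remove_minimal:
  assumes I: "I \<in> Ab" "I \<noteq> {}"
  shows "\<exists>\<gamma>\<in>I. I - {\<gamma>} \<in> Ab"
proof -
  have fin: "finite I" using finite_abelian I by blast
  then obtain \<gamma> where g: "\<gamma> \<in> I" "Min (height ` I) = height \<gamma>"
    using obtains_MIN[of I height] I(2) by auto
  hence min: "height \<gamma> \<le> height \<nu>" if "\<nu> \<in> I" for \<nu>
    using that fin Min_le[of "height ` I"] by auto
  have "\<nu> \<in> I - {\<gamma>}" if "\<beta> \<in> I - {\<gamma>}" "\<nu> \<in> P" "coef_le \<beta> \<nu>" for \<beta> \<nu>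
    using abelian_upper[OF I(1)] min[of \<beta>] coef_le_height_eq[of \<beta> \<nu>] that by blast
  hence "I - {\<gamma>} \<in> Ab"
    unfolding abelian_ideal_iff using abelian_pos[OF I(1)] abelian_sum[OF I(1)] by blast
  thus ?thesis using g(1) by blast
qed

section \<open>The elements \<open>w\<^sub>I\<close>\<close>

definition is_ideal_elt :: "'a set \<Rightarrow> ('a affine_space \<Rightarrow> 'a affine_space) \<Rightarrow> bool" where
  "is_ideal_elt I w \<longleftrightarrow> w \<in> W \<and> inversions \<Phi> S w = (\<lambda>\<gamma>. (- \<gamma>, 1, 0)) ` I"

text \<open>\<open>is_ideal_elt\<close> is the defining property of \<open>w\<^sub>I\<close>, with
  \<open>\<delta> - \<gamma>\<close> spelled as a triple. As inversion sets determine elements, any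
  witness is the one described.\<close>

lemma ideal_elt_eq: "is_ideal_elt I w \<Longrightarrow> ideal_elt \<Phi> S I = w"
proof -
  assume w: "is_ideal_elt I w"
  have e: "{delta - emb \<gamma> | \<gamma>. \<gamma> \<in> I} = (\<lambda>\<gamma>. (- \<gamma>, 1, 0)) ` I"
    by (auto simp: delta_def emb_def)
  show ?thesis unfolding ideal_elt_def e
  proof (rule the_equality)
    show "w \<in> W \<and> inversions \<Phi> S w = (\<lambda>\<gamma>. (- \<gamma>, 1, 0)) ` I" using w by (simp add: is_ideal_elt_def)
    fix v assume "v \<in> W \<and> inversions \<Phi> S v = (\<lambda>\<gamma>. (- \<gamma>, 1, 0)) ` I"
    thus "v = w" using w inversions_unique[of v w] by (simp add: is_ideal_elt_def)
  qed
qed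

lemma ideal_elt_inversion:
  "is_ideal_elt I w \<Longrightarrow> x \<in> PA \<Longrightarrow> - w x \<in> PA \<longleftrightarrow> (\<exists>\<gamma>\<in>I. x = (- \<gamma>, 1, 0))"
  unfolding is_ideal_elt_def inversions_def by blast

text \<open>If the positive root \<open>\<nu> = w (\<delta> - \<gamma>)\<close> were not simple, then \<open>\<nu> = p \<cdot> a + s\<^sub>a \<nu>\<close> for some simple
  \<open>a\<close> and \<open>p \<ge> 1\<close>. Pulling back along \<open>w\<close> gives \<open>\<delta> - \<gamma> = p \<cdot> x + y\<close>, and each combination of signs
  of the roots \<open>x\<close> and \<open>y\<close> contradicts the description of the inversion set of \<open>w\<close>.\<close>

lemma ideal_elt_extend_simple:
  assumes w: "is_ideal_elt I w" and g: "\<gamma> \<notin> I" and J: "insert \<gamma> I \<in> Ab"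
  shows "w (- \<gamma>, 1, 0) \<in> SA"
proof (rule ccontr)
  let ?d = "(- \<gamma>, 1, 0) :: 'a affine_space"
  let ?\<nu> = "w ?d"
  assume ns: "?\<nu> \<notin> SA"
  have wW: "w \<in> W" using w by (simp add: is_ideal_elt_def)
  have gP: "\<gamma> \<in> P" using abelian_pos J by blast
  hence gR: "\<gamma> \<in> \<Phi>" by (rule pos_root)
  have up: "\<nu> \<in> I" if "\<nu> \<in> P" "coef_le \<beta> \<nu>" "\<beta> \<in> insert \<gamma> I" "\<nu> \<noteq> \<gamma>" for \<beta> \<nu>
    using abelian_upper[OF J] that by blast
  have inv: "- w (- \<nu>, 1, 0) \<in> PA" if "\<nu> \<in> I" for \<nu>
  proof -
    have "\<nu> \<in> \<Phi>" using abelian_pos[OF J] pos_root that by blast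
    hence "(- \<nu>, 1, 0) \<in> PA" by (simp add: pos_affine_iff uminus_root)
    thus ?thesis using ideal_elt_inversion[OF w] that by blast
  qed
  have dP: "?d \<in> PA" using gR by (simp add: pos_affine_iff uminus_root)
  hence "- ?\<nu> \<notin> PA" using ideal_elt_inversion[OF w dP] g by auto
  hence nP: "?\<nu> \<in> PA" using real_root_cases affine_weyl_real[OF wW] pos_affine_real[OF dP] by blast
  then obtain a where a: "a \<in> SA" "aff_form ?\<nu> a > 0" using pos_affine_simple_form by blast
  have sP: "aff_reflection a ?\<nu> \<in> PA" using aff_reflection_pos a(1) nP ns by blast
  have aP: "a \<in> PA" using simple_affine_pos a(1) by blast
  obtain w' where w': "w' \<in> W" "w' \<circ> w = id" "w \<circ> w' = id" using affine_weyl_inverse wW by blast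
  \<comment> \<open>These are the preimages of \<open>a\<close> and of the reflected root, so that
    \<open>\<delta> - \<gamma> = p x + y\<close>.\<close>
  define x where "x = w' a"
  define y where "y = aff_reflection x ?d"
  have wx: "w x = a" using w'(3) by (metis comp_apply id_apply x_def)
  have wy: "w y = aff_reflection a ?\<nu>"
    unfolding y_def using aff_reflection_conj[OF affine_weyl_linear[OF wW] affine_weyl_form[OF wW]] wx by blast
  have xR: "x \<in> real_roots" unfolding x_def using affine_weyl_real w'(1) aP pos_affine_real by blast
  then obtain b k where x: "x = (b, k, 0)" and b: "b \<in> \<Phi>" and kI: "k \<in> \<int>" by (auto simp: real_roots_def)
  define p where "p = cartan (- \<gamma>) b"
  have y: "y = (- \<gamma> - p *\<^sub>R b, 1 - p * k, 0)"
    by (simp add: y_def x aff_reflection_root p_def)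
  have yR: "y \<in> real_roots" unfolding y_def using aff_reflection_real xR dP pos_affine_real by blast
  hence yf: "- \<gamma> - p *\<^sub>R b \<in> \<Phi>" by (auto simp: y real_roots_iff)
  have "aff_form ?d x > 0" using affine_weyl_form[OF wW, of ?d x] a(2) wx by simp
  hence gb: "\<gamma> \<bullet> b < 0" by (simp add: x)
  have p1: "p \<ge> 1" unfolding p_def using cartan_pos_ge_1[OF b uminus_root[OF gR]] gb by simp
  have pI: "p \<in> \<int>" unfolding p_def using cartan_Ints[OF b uminus_root[OF gR]] .
  have xneg: "\<exists>\<nu>\<in>I. - x = (- \<nu>, 1, 0)" if "- x \<in> PA"
    using ideal_elt_inversion[OF w that] affine_weyl_uminus[OF wW] wx aP by simp
  have yneg: "\<exists>\<nu>\<in>I. - y = (- \<nu>, 1, 0)" if "- y \<in> PA"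
    using ideal_elt_inversion[OF w that] affine_weyl_uminus[OF wW] wy sP by simp
  have xI: "x \<noteq> (- \<nu>, 1, 0)" "y \<noteq> (- \<nu>, 1, 0)" if "\<nu> \<in> I" for \<nu>
    using inv[OF that] wx wy pos_affine_not_neg[OF aP] pos_affine_not_neg[OF sP] by metis+
  obtain pn kn where pk: "p = of_int pn" "k = of_int kn" using pI kI by (auto elim!: Ints_cases)
  have pn1: "pn \<ge> 1" using p1 pk by simp
  consider (xn) "- x \<in> PA" | (yn) "- y \<in> PA" | (pp) "x \<in> PA" "y \<in> PA"
    using real_root_cases xR yR by blast
  thus False
  proof cases
    case xn
    \<comment> \<open>Here \<open>x = \<nu> - \<delta>\<close> with \<open>\<nu> \<in> I\<close>,
      and the negative product with \<open>\<gamma>\<close> makes \<open>\<gamma> + \<nu>\<close> a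
      root.\<close>
    then obtain \<nu> where n: "\<nu> \<in> I" "b = \<nu>" using xneg x by auto
    have "\<gamma> \<noteq> - \<nu>" using pos_not_neg[of \<nu>] gP abelian_pos[OF J, of \<nu>] n by auto
    hence "\<gamma> + \<nu> \<in> \<Phi>" using root_add[OF gR b] gb n by auto
    thus False using abelian_sum[OF J] n by blast
  next
    case yn
    then obtain \<nu> where \<nu>: "\<nu> \<in> I" "- y = (- \<nu>, 1, 0)" using yneg by blast
    have "y = (\<nu>, -1, 0)" using arg_cong[OF \<nu>(2), of uminus] by simp
    \<comment> \<open>Levels give \<open>1 - p * k = -1\<close>. This leaves \<open>p = 1\<close>,
      where \<open>\<gamma> + \<nu> = - b\<close> is a root, and \<open>p = 2\<close>.\<close>
    hence n: "\<nu> \<in> I" "- \<gamma> - p *\<^sub>R b = \<nu>" "p * k = 2" using \<nu>(1) by (simp_all add: y)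
    have nP: "\<nu> \<in> P" using abelian_pos[OF J] n by blast
    have "real_of_int (pn * kn) = real_of_int 2" using n(3) pk by simp
    hence pk2: "pn * kn = 2" by (simp only: of_int_eq_iff)
    hence "pn dvd 2" by (metis dvd_triv_left)
    hence "pn \<le> 2" using zdvd_imp_le by simp
    with pn1 consider "pn = 1" | "pn = 2" by linarith
    thus False
    proof cases
      case 1
      have "\<gamma> + \<nu> = - b" using pk 1 by (simp add: n(2)[symmetric])
      hence "\<gamma> + \<nu> \<in> \<Phi>" using b uminus_root by simp
      thus False using abelian_sum[OF J] n by blast
    next
      case 2
      hence k1: "k = 1" using pk2 pk by simp
      \<comment> \<open>Now \<open>- b\<close> is the midpoint of \<open>\<gamma>\<close> and
        \<open>\<nu>\<close> and comparable with \<open>\<gamma>\<close>, so one of the two lies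
        below it and forces it into \<open>I\<close>.\<close>
      have s: "\<nu> + \<gamma> = 2 *\<^sub>R (- b)" using pk 2 by (simp add: n(2)[symmetric])
      have bP: "- b \<in> P"
      proof -
        have "coef \<alpha> (\<nu> + \<gamma>) \<ge> coef \<alpha> \<gamma>" if "\<alpha> \<in> S" for \<alpha> using pos_coef_nonneg[OF nP that] by simp
        moreover obtain \<alpha> where "\<alpha> \<in> S" "coef \<alpha> \<gamma> > 0" using pos_iff_coef_pos[OF gR] gP by blast
        ultimately have "coef \<alpha> (2 *\<^sub>R (- b)) > 0" using s by (metis order_less_le_trans)
        hence "coef \<alpha> (- b) > 0" by simp
        thus ?thesis using pos_iff_coef_pos[OF uminus_root[OF b]] \<open>\<alpha> \<in> S\<close> by blast
      qed
      have ne: "\<gamma> \<noteq> - b"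
      proof
        assume "\<gamma> = - b"
        hence "\<nu> = \<gamma>" using s by (simp add: scaleR_2)
        thus False using n g by blast
      qed
      have "\<gamma> - (- b) \<in> \<Phi>" using root_diff[OF gR uminus_root[OF b] _ ne] gb by simp
      then consider "\<gamma> - (- b) \<in> P" | "- b - \<gamma> \<in> P"
        using pos_or_neg unfolding minus_diff_eq[of \<gamma> "- b", symmetric] by blast
      hence "\<exists>\<beta>\<in>insert \<gamma> I. coef_le \<beta> (- b)"
      proof cases
        case 1
        have "- b = \<nu> + (\<gamma> - (- b))" using s by (simp add: scaleR_2 algebra_simps)
        hence "coef_le \<nu> (- b)" using coef_le_add_pos[OF 1, of \<nu>] by simp
        thus ?thesis using n by blast
      next
        case 2
        have "coef_le \<gamma> (- b)" using coef_le_add_pos[OF 2, of \<gamma>] by simp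
        thus ?thesis by blast
      qed
      hence "- b \<in> I" using up[OF bP] ne by blast
      thus False using xI(1)[of "- b"] x k1 by simp
    qed
  next
    case pp
    \<comment> \<open>Nonnegative levels leave \<open>k = 0\<close>, where
      \<open>\<gamma> + p b\<close> lies above \<open>\<gamma>\<close>, and
      \<open>p = k = 1\<close>, where \<open>- b\<close> does.\<close>
    have k0: "k \<ge> 0" "1 - p * k \<ge> 0" using pp x y by (auto simp: pos_affine_iff)
    hence "k = 0 \<or> (p = 1 \<and> k = 1)"
    proof -
      have "kn \<ge> 0" using k0 pk by simp
      have "real_of_int (pn * kn) \<le> real_of_int 1" using k0 pk by simp
      hence "pn * kn \<le> 1" by (simp only: of_int_le_iff)
      have "1 * kn \<le> pn * kn" using pn1 \<open>kn \<ge> 0\<close> by (rule mult_right_mono)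
      hence "kn = 0 \<or> kn = 1" using \<open>pn * kn \<le> 1\<close> \<open>kn \<ge> 0\<close> by linarith
      hence "kn = 0 \<or> (kn = 1 \<and> pn = 1)" using \<open>pn * kn \<le> 1\<close> pn1 by auto
      thus ?thesis using pk by auto
    qed
    thus False
    proof (elim disjE conjE)
      assume k: "k = 0"
      have bP: "b \<in> P" using pp(1) x k by (simp add: pos_affine_iff)
      have "- (\<gamma> + p *\<^sub>R b) \<in> \<Phi>" using yf by simp
      hence r: "\<gamma> + p *\<^sub>R b \<in> \<Phi>" using uminus_root_iff by blast
      have le: "coef_le \<gamma> (\<gamma> + p *\<^sub>R b)" using pos_coef_nonneg[OF bP] p1 by (simp add: coef_le_def)
      hence "\<gamma> + p *\<^sub>R b \<in> P" using pos_coef_geI[OF gP r] by (simp add: coef_le_def)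
      moreover have "\<gamma> + p *\<^sub>R b \<noteq> \<gamma>" using p1 b zero_not_root by auto
      ultimately have "\<gamma> + p *\<^sub>R b \<in> I" using up le by blast
      thus False using xI(2)[of "\<gamma> + p *\<^sub>R b"] y k by simp
    next
      assume p: "p = 1" and k: "k = 1"
      have yP: "- \<gamma> - b \<in> P" using pp(2) y p k by (simp add: pos_affine_iff)
      have bP: "- b \<in> P" using pos_add[OF gP yP] uminus_root[OF b] by simp
      have "- b \<noteq> \<gamma>" using pos_root[OF yP] zero_not_root by auto
      moreover have "coef_le \<gamma> (- b)" using coef_le_add_pos[OF yP, of \<gamma>] by simp
      ultimately have "- b \<in> I" using up bP by blast
      thus False using xI(1)[of "- b"] x k by simp
    qed
  qed
qed

lemma ideal_elt_extend:
  assumes w: "is_ideal_elt I w" and \<gamma>: "\<gamma> \<in> \<Phi>" and a: "w (- \<gamma>, 1, 0) \<in> SA"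
  shows "is_ideal_elt (insert \<gamma> I) (aff_reflection (w (- \<gamma>, 1, 0)) \<circ> w)"
proof -
  have "(- \<gamma>, 1, 0) \<in> PA" using \<gamma> by (simp add: pos_affine_iff uminus_root)
  moreover have wW: "w \<in> W" using w by (simp add: is_ideal_elt_def)
  ultimately have "inversions \<Phi> S (aff_reflection (w (- \<gamma>, 1, 0)) \<circ> w) = insert (- \<gamma>, 1, 0) (inversions \<Phi> S w)"
    using inversions_reflection a by blast
  also have "\<dots> = (\<lambda>\<gamma>. (- \<gamma>, 1, 0)) ` insert \<gamma> I" using w by (simp add: is_ideal_elt_def)
  finally show ?thesis using affine_weyl.refl[OF a wW] by (simp only: is_ideal_elt_def)
qed

text \<open>Strip one root, take the element for the rest, and put the root back by one simple
  reflection.\<close>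

lemma ideal_elt_exists:
  assumes "I \<in> Ab"
  shows "\<exists>w. is_ideal_elt I w"
  using assms
proof (induction "card I" arbitrary: I rule: less_induct)
  case less
  show ?case
  proof (cases "I = {}")
    case True
    have "is_ideal_elt I id" using pos_affine_not_neg True
      by (auto simp: is_ideal_elt_def inversions_def affine_weyl.id)
    thus ?thesis by blast
  next
    case False
    then obtain \<gamma> where g: "\<gamma> \<in> I" "I - {\<gamma>} \<in> Ab" using abelian_remove_minimal less.prems by blast
    have "card (I - {\<gamma>}) < card I" using g(1) finite_abelian[OF less.prems] by (rule card_Diff1_less[rotated])
    then obtain w where w: "is_ideal_elt (I - {\<gamma>}) w" using less.hyps g(2) by blast
    have e: "insert \<gamma> (I - {\<gamma>}) = I" using g(1) by blast
    have "w (- \<gamma>, 1, 0) \<in> SA"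
      by (rule ideal_elt_extend_simple[OF w]) (simp_all only: e less.prems, simp)
    moreover have "\<gamma> \<in> \<Phi>" using abelian_pos[OF less.prems g(1)] pos_root by blast
    ultimately show ?thesis using ideal_elt_extend[OF w] e by metis
  qed
qed

text \<open>Levels of positive roots are nonnegative, so all three would vanish, which reduces the
  claim to finite roots. The sum itself need not be a root.\<close>

lemma pos_affine_add: "x \<in> PA \<Longrightarrow> y \<in> PA \<Longrightarrow> - (x + y) \<notin> PA"
proof
  assume *: "x \<in> PA" "y \<in> PA" "- (x + y) \<in> PA"
  obtain v k u j where xy: "x = (v, k, 0)" "y = (u, j, 0)" using *(1,2)
    by (cases x; cases y) (auto simp: pos_affine_iff)
  hence "v \<in> P" "u \<in> P" "- (v + u) \<in> P" using * by (auto simp: pos_affine_iff)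
  moreover from this have "v + u \<in> \<Phi>" using pos_root uminus_root_iff by blast
  ultimately show False using pos_add pos_not_neg by blast
qed

text \<open>The inversion set of \<open>w\<close> is closed under sums, and it contains with the sum of two positive
  roots at least one of the summands.\<close>

lemma abelian_if_ideal_elt:
  assumes w: "is_ideal_elt I w" and IP: "I \<subseteq> P"
  shows "I \<in> Ab"
proof -
  have wW: "w \<in> W" using w by (simp add: is_ideal_elt_def)
  have add: "w (x + y) = w x + w y" for x y using linear_add[OF affine_weyl_linear[OF wW]] .
  have sign: "- w x \<in> PA \<or> w x \<in> PA" if "x \<in> PA" for x
    using real_root_cases affine_weyl_real[OF wW] pos_affine_real that by blast
  have ipos: "(- \<gamma>, 1, 0) \<in> PA" if "\<gamma> \<in> P" for \<gamma>
    using pos_root[OF that] by (simp add: pos_affine_iff uminus_root)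
  have neg_iff: "- w (- \<gamma>, 1, 0) \<in> PA \<longleftrightarrow> \<gamma> \<in> I" if "\<gamma> \<in> P" for \<gamma>
    using ideal_elt_inversion[OF w ipos[OF that]] by auto
  have step: "\<nu> \<in> I" if "\<gamma> \<in> I" "root_covers \<Phi> S \<nu> \<gamma>" for \<gamma> \<nu>
  proof (rule ccontr)
    assume no: "\<nu> \<notin> I"
    define \<alpha> where "\<alpha> = \<nu> - \<gamma>"
    have P: "\<nu> \<in> P" "\<gamma> \<in> P" "\<alpha> \<in> P" using that(2) simple_pos by (auto simp: root_covers_def \<alpha>_def)
    have aP: "(\<alpha>, 0, 0) \<in> PA" using P pos_root by (simp add: pos_affine_iff)
    hence "w (\<alpha>, 0, 0) \<in> PA" using sign ideal_elt_inversion[OF w aP] by auto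
    moreover have "w (- \<nu>, 1, 0) \<in> PA" using sign ipos[OF P(1)] neg_iff[OF P(1)] no by blast
    \<comment> \<open>Both summands of
      \<open>\<delta> - \<gamma> = (\<delta> - \<nu>) + \<alpha>\<close> stay positive under
      \<open>w\<close>, yet the sum is inverted.\<close>
    moreover have "(- \<gamma>, 1::real, 0::real) = (- \<nu>, 1, 0) + (\<alpha>, 0, 0)" by (simp add: \<alpha>_def)
    ultimately show False
      using pos_affine_add add[of "(- \<nu>, 1, 0)" "(\<alpha>, 0, 0)"] neg_iff[OF P(2)] that(1) by metis
  qed
  have upper: "\<nu> \<in> I" if "root_le \<Phi> S \<gamma> \<nu>" "\<gamma> \<in> I" for \<gamma> \<nu>
    using that unfolding root_le_def by (induction rule: rtranclp_induct) (auto intro: step)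
  have sum: "\<gamma> + \<nu> \<notin> \<Phi>" if I: "\<gamma> \<in> I" "\<nu> \<in> I" for \<gamma> \<nu>
  proof
    assume r: "\<gamma> + \<nu> \<in> \<Phi>"
    have P: "\<gamma> \<in> P" "\<nu> \<in> P" using I IP by auto
    \<comment> \<open>A root of level 2 is never an inversion, although both of its summands
      are.\<close>
    have dP: "(- (\<gamma> + \<nu>), 2, 0) \<in> PA" using uminus_root[OF r] by (simp add: pos_affine_iff)
    hence "w (- (\<gamma> + \<nu>), 2, 0) \<in> PA" using sign ideal_elt_inversion[OF w dP] by auto
    moreover have "(- (\<gamma> + \<nu>), 2::real, 0::real) = (- \<gamma>, 1, 0) + (- \<nu>, 1, 0)" by simp
    ultimately have "- (- w (- \<gamma>, 1, 0) + - w (- \<nu>, 1, 0)) \<in> PA"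
      using add[of "(- \<gamma>, 1, 0)" "(- \<nu>, 1, 0)"] by (simp add: add.commute)
    thus False using pos_affine_add neg_iff P I by blast
  qed
  show ?thesis unfolding abelian_ideal_iff
    using IP upper sum root_le_iff by blast
qed

section \<open>Covers leaving a fibre\<close>

lemma pos_diff_simple:
  assumes mP: "\<mu> \<in> P" and ns: "\<mu> \<notin> S" and aS: "\<alpha> \<in> S" and am: "\<mu> \<bullet> \<alpha> > 0"
  shows "\<mu> - \<alpha> \<in> P"
proof -
  have mR: "\<mu> \<in> \<Phi>" and aR: "\<alpha> \<in> \<Phi>" using mP pos_root aS simple_root by auto
  have ne: "\<mu> \<noteq> \<alpha>" using ns aS by auto
  \<comment> \<open>The reflected root is positive and lies coordinatewise below
    \<open>\<mu> - \<alpha>\<close>, as the Cartan integer is at least 1.\<close>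
  have "\<mu> - cartan \<mu> \<alpha> *\<^sub>R \<alpha> \<in> P" using reflect_simple_pos mP aS ne by blast
  then obtain \<beta> where b: "\<beta> \<in> S" "coef \<beta> (\<mu> - cartan \<mu> \<alpha> *\<^sub>R \<alpha>) > 0"
    using pos_iff_coef_pos pos_root by blast
  have "coef \<beta> \<alpha> \<le> cartan \<mu> \<alpha> * coef \<beta> \<alpha>"
    using cartan_pos_ge_1[OF aR mR am] by (simp add: coef_simple[OF aS])
  hence "coef \<beta> (\<mu> - \<alpha>) > 0" using b(2) by simp
  thus ?thesis using pos_iff_coef_pos[OF root_diff[OF mR aR am ne]] b(1) by blast
qed

definition simple_above :: "'a \<Rightarrow> 'a set" where
  "simple_above \<mu> = {\<alpha> \<in> S. \<mu> \<bullet> \<alpha> > 0}"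

lemma tau_eq: "is_ideal_elt I w \<Longrightarrow> tau \<Phi> S I = w (- \<theta>, 2, 0)"
  using ideal_elt_eq by (simp add: tau_def delta_def emb_def)

text \<open>Dominance of \<open>\<theta>\<close> excludes positive \<open>v\<close>. If
  \<open>v + k\<delta>\<close> were negative, its negative would be an inversion
  \<open>\<delta> - \<gamma>\<close>, making \<open>v = \<gamma>\<close> positive after all.\<close>

lemma ideal_elt_preimage_pos:
  assumes I: "I \<in> Ab" and w: "is_ideal_elt I w" and \<nu>: "\<nu> \<in> P"
    and v: "v \<in> \<Phi>" "k \<in> \<int>" "w (v, k, 0) = (\<nu>, 0, 0)" and neg: "v \<bullet> \<theta> < 0"
  shows "- v \<in> P \<and> k \<ge> 1"
proof -
  have wW: "w \<in> W" using w by (simp add: is_ideal_elt_def)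
  have nP: "(\<nu>, 0, 0) \<in> PA" using \<nu> pos_root by (simp add: pos_affine_iff)
  have vnP: "v \<notin> P" using highest_dominant neg by force
  hence "- v \<in> P" using v pos_or_neg by blast
  moreover have "(v, k, 0) \<in> PA"
  proof (rule ccontr)
    assume "(v, k, 0) \<notin> PA"
    hence p: "- (v, k, 0) \<in> PA" using real_root_cases[of "(v, k, 0)"] v by (simp add: real_roots_iff)
    have "- w (- (v, k, 0)) \<in> PA" unfolding affine_weyl_uminus[OF wW] using v(3) nP by simp
    then obtain \<gamma> where \<gamma>: "\<gamma> \<in> I" "- (v, k, 0) = (- \<gamma>, 1, 0 :: real)"
      using ideal_elt_inversion[OF w p] by blast
    have "v = \<gamma>" using \<gamma>(2) by simp
    thus False using abelian_pos[OF I \<gamma>(1)] vnP by simp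
  qed
  ultimately show ?thesis using vnP v(2) by (auto simp: pos_affine_iff elim!: Ints_cases)
qed

text \<open>Provides the root whose addition to \<open>I\<close> gives the cover belonging to
  \<open>\<alpha>\<close>.\<close>

lemma fibre_simple_preimage:
  assumes I: "I \<in> Ab" and w: "is_ideal_elt I w" and \<mu>: "w (- \<theta>, 2, 0) = (\<mu>, 0, 0)"
    and long: "\<mu> \<in> long_pos_roots \<Phi> S" and ns: "\<mu> \<notin> S" and \<alpha>: "\<alpha> \<in> simple_above \<mu>"
  shows "\<exists>\<gamma>\<in>P. w (- \<gamma>, 1, 0) = (\<alpha>, 0, 0)"
proof -
  have wW: "w \<in> W" using w by (simp add: is_ideal_elt_def)
  have aS: "\<alpha> \<in> S" and am: "\<mu> \<bullet> \<alpha> > 0" using \<alpha> by (auto simp: simple_above_def)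
  have mP: "\<mu> \<in> P" and max: "\<And>\<beta>. \<beta> \<in> \<Phi> \<Longrightarrow> norm \<beta> \<le> norm \<mu>" using long by (auto simp: long_pos_roots_def)
  have mR: "\<mu> \<in> \<Phi>" and aR: "\<alpha> \<in> \<Phi>" using mP pos_root aS simple_root by auto
  have ne: "\<mu> \<noteq> \<alpha>" using ns aS by auto
  have dR: "\<mu> - \<alpha> \<in> \<Phi>" using root_diff mR aR am ne by blast
  have dP: "\<mu> - \<alpha> \<in> P" using pos_diff_simple mP ns aS am by blast
  \<comment> \<open>As \<open>\<mu>\<close> is long and differs from \<open>\<alpha>\<close>, the
    Cartan integer of \<open>\<alpha>\<close> at \<open>\<mu>\<close> is exactly 1. Thus
    \<open>\<mu> - \<alpha>\<close> has the same positive product with \<open>\<mu>\<close> as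
    \<open>\<alpha>\<close>.\<close>
  have half: "2 * (\<mu> \<bullet> \<alpha>) = \<mu> \<bullet> \<mu>"
  proof -
    obtain m where m: "cartan \<alpha> \<mu> = of_int m" using cartan_Ints[OF mR aR] by (rule Ints_cases)
    have "cartan \<alpha> \<mu> \<ge> 1" using cartan_pos_ge_1[OF mR aR] am by (simp add: inner_commute)
    moreover have "cartan \<alpha> \<mu> < 2"
    proof -
      have "norm \<alpha> \<le> norm \<mu>" using max aR by blast
      hence "\<alpha> \<bullet> \<alpha> \<le> \<mu> \<bullet> \<mu>" by (simp add: norm_le)
      moreover have "(\<mu> - \<alpha>) \<bullet> (\<mu> - \<alpha>) > 0" using ne by (simp del: inner_diff_left inner_diff_right)
      ultimately have "\<mu> \<bullet> \<alpha> < \<mu> \<bullet> \<mu>" by (simp add: inner_diff inner_commute)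
      thus ?thesis using root_norm_pos[OF mR] by (simp add: cartan_def inner_commute field_simps)
    qed
    ultimately have "cartan \<alpha> \<mu> = 1" using m by simp
    thus ?thesis using root_norm_pos[OF mR] by (simp add: cartan_def inner_commute field_simps)
  qed
  obtain w' where w': "w' \<in> W" "w' \<circ> w = id" "w \<circ> w' = id" using affine_weyl_inverse wW by blast
  \<comment> \<open>The product of a preimage with \<open>2\<delta> - \<theta>\<close>, the preimage
    of \<open>\<mu>\<close>, does not see its level.\<close>
  have pre: "\<exists>v k. v \<in> \<Phi> \<and> k \<in> \<int> \<and> w (v, k, 0) = (\<nu>, 0, 0) \<and> - (v \<bullet> \<theta>) = \<nu> \<bullet> \<mu>"
    if "\<nu> \<in> \<Phi>" for \<nu>
  proof -
    have "w' (\<nu>, 0, 0) \<in> real_roots" using affine_weyl_real[OF w'(1)] that by (simp add: real_roots_iff)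
    then obtain v k where vk: "w' (\<nu>, 0, 0) = (v, k, 0)" "v \<in> \<Phi>" "k \<in> \<int>" by (auto simp: real_roots_def)
    have wv: "w (v, k, 0) = (\<nu>, 0, 0)" using w'(3) vk(1) by (metis comp_apply id_apply)
    have "aff_form (w (v, k, 0)) (w (- \<theta>, 2, 0)) = aff_form (v, k, 0) (- \<theta>, 2, 0)" using affine_weyl_form[OF wW] .
    hence "- (v \<bullet> \<theta>) = \<nu> \<bullet> \<mu>" by (simp add: wv \<mu>)
    thus ?thesis using vk wv by blast
  qed
  obtain v k where v: "v \<in> \<Phi>" "k \<in> \<int>" "w (v, k, 0) = (\<alpha>, 0, 0)" "- (v \<bullet> \<theta>) = \<alpha> \<bullet> \<mu>"
    using pre[OF aR] by blast
  obtain u j where u: "u \<in> \<Phi>" "j \<in> \<int>" "w (u, j, 0) = (\<mu> - \<alpha>, 0, 0)" "- (u \<bullet> \<theta>) = (\<mu> - \<alpha>) \<bullet> \<mu>"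
    using pre[OF dR] by blast
  have "v \<bullet> \<theta> < 0" using v(4) am by (simp add: inner_commute)
  hence 1: "- v \<in> P" "k \<ge> 1" using ideal_elt_preimage_pos[OF I w simple_pos[OF aS] v(1-3)] by auto
  have "u \<bullet> \<theta> < 0" using u(4) half am by (simp add: inner_diff inner_commute)
  hence 2: "j \<ge> 1" using ideal_elt_preimage_pos[OF I w dP u(1-3)] by auto
  \<comment> \<open>The two preimages add up to \<open>2\<delta> - \<theta>\<close>, so levels that
    are at least 1 must both be 1.\<close>
  have "w (v + u, k + j, 0) = w (v, k, 0) + w (u, j, 0)"
    using linear_add[OF affine_weyl_linear[OF wW], of "(v, k, 0)" "(u, j, 0)"] by simp
  also have "\<dots> = w (- \<theta>, 2, 0)" by (simp add: v(3) u(3) \<mu>)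
  finally have "(v + u, k + j, 0) = (- \<theta>, 2, 0)" using affine_weyl_inj[OF wW] by (auto dest: injD)
  hence "k = 1" using 1 2 by simp
  thus ?thesis using 1 v(3) by (intro bexI[of _ "- v"]) simp_all
qed

lemma ideal_covers_insert:
  assumes "ideal_covers \<Phi> S J I"
  shows "\<exists>\<gamma>. \<gamma> \<notin> I \<and> J = insert \<gamma> I"
proof -
  have IJ: "I \<in> Ab" "J \<in> Ab" "I \<subset> J" using assms by (auto simp: ideal_covers_def)
  then obtain \<gamma> where g: "\<gamma> \<in> J - I" "insert \<gamma> I \<in> Ab" using abelian_insert by blast
  hence "\<not> insert \<gamma> I \<subset> J" using assms unfolding ideal_covers_def by blast
  thus ?thesis using g IJ by blast
qed

lemma ideal_covers_insertI: "I \<in> Ab \<Longrightarrow> insert \<gamma> I \<in> Ab \<Longrightarrow> \<gamma> \<notin> I \<Longrightarrow> ideal_covers \<Phi> S (insert \<gamma> I) I"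
  unfolding ideal_covers_def by blast

text \<open>The bijection sends \<open>\<alpha>\<close> to the cover that adds the root
  \<open>\<gamma>\<close> with \<open>w (\<delta> - \<gamma>) = \<alpha>\<close>.\<close>

lemma card_covers_leaving_fibre:
  assumes long: "\<mu> \<in> long_pos_roots \<Phi> S" and ns: "\<mu> \<notin> S" and I: "I \<in> ideal_fibre \<Phi> S \<mu>"
  shows "card {J. ideal_covers \<Phi> S J I \<and> J \<notin> ideal_fibre \<Phi> S \<mu>} = card (simple_above \<mu>)"
proof -
  let ?C = "{J. ideal_covers \<Phi> S J I \<and> J \<notin> ideal_fibre \<Phi> S \<mu>}"
  have IA: "I \<in> Ab" and tauI: "tau \<Phi> S I = emb \<mu>" using I by (auto simp: ideal_fibre_def)
  obtain w where w: "is_ideal_elt I w" using ideal_elt_exists IA by blast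
  have wW: "w \<in> W" using w by (simp add: is_ideal_elt_def)
  have \<mu>: "w (- \<theta>, 2, 0) = (\<mu>, 0, 0)" using tau_eq[OF w] tauI by (simp add: emb_def)
  have mP: "\<mu> \<in> P" using long by (simp add: long_pos_roots_def)
  \<comment> \<open>Adding \<open>\<gamma>\<close> replaces \<open>\<mu>\<close> by its reflection
    in \<open>w (\<delta> - \<gamma>)\<close>, which fixes \<open>\<mu>\<close> only in case of
    orthogonality.\<close>
  have in_fibre: "insert \<gamma> I \<in> ideal_fibre \<Phi> S \<mu> \<longleftrightarrow> aff_form (\<mu>, 0, 0) (w (- \<gamma>, 1, 0)) = 0"
    if J: "insert \<gamma> I \<in> Ab" and a: "w (- \<gamma>, 1, 0) \<in> SA" for \<gamma>
  proof -
    let ?a = "w (- \<gamma>, 1, 0)"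
    have "\<gamma> \<in> \<Phi>" using abelian_pos[OF J] pos_root by blast
    hence "is_ideal_elt (insert \<gamma> I) (aff_reflection ?a \<circ> w)" using ideal_elt_extend w a by blast
    hence "tau \<Phi> S (insert \<gamma> I) = aff_reflection ?a (\<mu>, 0, 0)" using tau_eq \<mu> by fastforce
    moreover have "?a \<noteq> 0" using simple_affine_form[OF a] by (auto simp: zero_prod_def)
    ultimately have "tau \<Phi> S (insert \<gamma> I) = emb \<mu> \<longleftrightarrow> aff_form (\<mu>, 0, 0) ?a = 0"
      using simple_affine_form[OF a] by (simp add: aff_reflection_def emb_def)
    thus ?thesis using J by (simp add: ideal_fibre_def)
  qed
  define g where "g \<alpha> = (THE \<gamma>. w (- \<gamma>, 1, 0) = (\<alpha>, 0, 0))" for \<alpha>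
  have gI: "g \<alpha> = \<gamma>" if "w (- \<gamma>, 1, 0) = (\<alpha>, 0, 0)" for \<gamma> \<alpha>
    unfolding g_def
  proof (rule the_equality)
    show "w (- \<gamma>, 1, 0) = (\<alpha>, 0, 0)" by (rule that)
    fix \<nu> assume "w (- \<nu>, 1, 0) = (\<alpha>, 0, 0)"
    hence "(- \<nu>, 1::real, 0::real) = (- \<gamma>, 1, 0)" using that affine_weyl_inj[OF wW] by (metis injD)
    thus "\<nu> = \<gamma>" by simp
  qed
  have g: "g \<alpha> \<in> P" "w (- g \<alpha>, 1, 0) = (\<alpha>, 0, 0)" if "\<alpha> \<in> simple_above \<mu>" for \<alpha>
    using fibre_simple_preimage[OF IA w \<mu> long ns that] gI by auto
  \<comment> \<open>Members of \<open>I\<close> give inversions of \<open>w\<close>, but here the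
    image is the positive root \<open>\<alpha>\<close>.\<close>
  have gnI: "g \<alpha> \<notin> I" if "\<alpha> \<in> simple_above \<mu>" for \<alpha>
  proof
    assume gi: "g \<alpha> \<in> I"
    have "(- g \<alpha>, 1, 0) \<in> PA" using g(1)[OF that] pos_root by (simp add: pos_affine_iff uminus_root)
    hence "- (\<alpha>, 0, 0) \<in> PA" using ideal_elt_inversion[OF w] gi g(2)[OF that] by metis
    moreover have "(\<alpha>, 0, 0) \<in> PA"
      using that simple_affine_pos by (simp add: simple_affine_iff simple_above_def)
    ultimately show False using pos_affine_not_neg by blast
  qed
  have "bij_betw (\<lambda>\<alpha>. insert (g \<alpha>) I) (simple_above \<mu>) ?C"
  proof (rule bij_betwI')
    fix \<alpha> \<beta> assume ab: "\<alpha> \<in> simple_above \<mu>" "\<beta> \<in> simple_above \<mu>"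
    show "insert (g \<alpha>) I = insert (g \<beta>) I \<longleftrightarrow> \<alpha> = \<beta>"
    proof
      assume "insert (g \<alpha>) I = insert (g \<beta>) I"
      hence "g \<alpha> = g \<beta>" using gnI ab by blast
      thus "\<alpha> = \<beta>" using g(2) ab by (metis prod.inject)
    qed simp
  next
    fix \<alpha> assume a: "\<alpha> \<in> simple_above \<mu>"
    have sa: "w (- g \<alpha>, 1, 0) \<in> SA" using g(2)[OF a] a by (simp add: simple_affine_iff simple_above_def)
    have "is_ideal_elt (insert (g \<alpha>) I) (aff_reflection (w (- g \<alpha>, 1, 0)) \<circ> w)"
      using ideal_elt_extend[OF w _ sa] g(1)[OF a] pos_root by blast
    moreover have "insert (g \<alpha>) I \<subseteq> P" using g(1)[OF a] abelian_pos[OF IA] by blast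
    ultimately have J: "insert (g \<alpha>) I \<in> Ab" by (rule abelian_if_ideal_elt)
    have "aff_form (\<mu>, 0, 0) (w (- g \<alpha>, 1, 0)) \<noteq> 0" using a by (simp add: g(2)[OF a] simple_above_def)
    thus "insert (g \<alpha>) I \<in> ?C"
      using in_fibre[OF J sa] ideal_covers_insertI[OF IA J gnI[OF a]] by blast
  next
    fix J assume J: "J \<in> ?C"
    then obtain \<gamma> where \<gamma>: "\<gamma> \<notin> I" "J = insert \<gamma> I" using ideal_covers_insert by blast
    have JA: "insert \<gamma> I \<in> Ab" using J \<gamma> by (simp add: ideal_covers_def)
    have gP: "\<gamma> \<in> P" using abelian_pos[OF JA] by blast
    have a: "w (- \<gamma>, 1, 0) \<in> SA" using ideal_elt_extend_simple[OF w \<gamma>(1) JA] .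
    have ne: "aff_form (\<mu>, 0, 0) (w (- \<gamma>, 1, 0)) \<noteq> 0" using in_fibre[OF JA a] J \<gamma>(2) by blast
    have "aff_form (w (- \<theta>, 2, 0)) (w (- \<gamma>, 1, 0)) = aff_form (- \<theta>, 2, 0) (- \<gamma>, 1, 0)"
      using affine_weyl_form[OF wW] .
    hence "aff_form (\<mu>, 0, 0) (w (- \<gamma>, 1, 0)) = \<gamma> \<bullet> \<theta>" by (simp add: \<mu> inner_commute)
    \<comment> \<open>A nonzero product is positive by dominance of \<open>\<theta>\<close>; this
      rules out \<open>\<alpha>\<^sub>0\<close>, whose product with \<open>\<mu>\<close> is at most
      0.\<close>
    hence pos: "aff_form (\<mu>, 0, 0) (w (- \<gamma>, 1, 0)) > 0" using ne highest_dominant[OF gP] by simp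
    from a consider "w (- \<gamma>, 1, 0) = (- \<theta>, 1, 0)" | \<alpha> where "\<alpha> \<in> S" "w (- \<gamma>, 1, 0) = (\<alpha>, 0, 0)"
      by (auto simp: simple_affine_iff)
    thus "\<exists>\<alpha>\<in>simple_above \<mu>. J = insert (g \<alpha>) I"
    proof cases
      case 1
      thus ?thesis using pos highest_dominant[OF mP] by simp
    next
      case 2
      thus ?thesis using pos gI \<gamma>(2) by (intro bexI[of _ \<alpha>]) (auto simp: simple_above_def)
    qed
  qed
  thus ?thesis by (simp add: bij_betw_same_card)
qed

text \<open>If \<open>\<mu> - \<alpha>\<close> is a root, equal lengths force
  \<open>2 * (\<mu> \<bullet> \<alpha>) = \<alpha> \<bullet> \<alpha>\<close>, hence a positive
  product; the converse is \<open>pos_diff_simple\<close>.\<close>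

lemma card_simple_above_simply_laced:
  assumes sl: "simply_laced \<Phi>" and mP: "\<mu> \<in> P" and ns: "\<mu> \<notin> S"
  shows "card (simple_above \<mu>) = kappa \<Phi> S \<mu>"
proof -
  have mR: "\<mu> \<in> \<Phi>" using mP pos_root by blast
  have eq: "\<mu> - \<alpha> \<in> P \<longleftrightarrow> \<mu> \<bullet> \<alpha> > 0" if a: "\<alpha> \<in> S" for \<alpha>
  proof
    assume d: "\<mu> - \<alpha> \<in> P"
    have aR: "\<alpha> \<in> \<Phi>" using a simple_root by blast
    have "norm (\<mu> - \<alpha>) = norm \<mu>" using sl d mR pos_root unfolding simply_laced_def by blast
    hence "(\<mu> - \<alpha>) \<bullet> (\<mu> - \<alpha>) = \<mu> \<bullet> \<mu>" by (simp only: norm_eq)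
    thus "\<mu> \<bullet> \<alpha> > 0" using root_norm_pos[OF aR] by (simp add: inner_diff inner_commute)
  next
    assume "\<mu> \<bullet> \<alpha> > 0"
    thus "\<mu> - \<alpha> \<in> P" using pos_diff_simple mP ns a by blast
  qed
  have "bij_betw (\<lambda>\<alpha>. \<mu> - \<alpha>) (simple_above \<mu>) {\<nu>. root_covers \<Phi> S \<mu> \<nu>}"
  proof (rule bij_betwI')
    fix \<nu> assume "\<nu> \<in> {\<nu>. root_covers \<Phi> S \<mu> \<nu>}"
    thus "\<exists>\<alpha>\<in>simple_above \<mu>. \<nu> = \<mu> - \<alpha>" using eq[of "\<mu> - \<nu>"]
      by (intro bexI[of _ "\<mu> - \<nu>"]) (auto simp: root_covers_def simple_above_def)
  qed (use eq mP in \<open>auto simp: root_covers_def simple_above_def\<close>)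
  thus ?thesis unfolding kappa_def by (rule bij_betw_same_card)
qed

end

theorem theorem4p7:
  fixes \<Phi> S :: "'a::euclidean_space set" and \<mu> :: 'a and I :: "'a set"
  assumes "root_system \<Phi>" and "reduced_roots \<Phi>" and "irreducible_roots \<Phi>"
    and "simple_roots \<Phi> S"
    and "\<mu> \<in> long_pos_roots \<Phi> S - S"
    and "I \<in> ideal_fibre \<Phi> S \<mu>"
  shows "card {I'. ideal_covers \<Phi> S I' I \<and> I' \<notin> ideal_fibre \<Phi> S \<mu>} = card {\<alpha> \<in> S. \<mu> \<bullet> \<alpha> > 0}
    \<and> (\<forall>J \<in> ideal_fibre \<Phi> S \<mu>.
          card {I'. ideal_covers \<Phi> S I' J \<and> I' \<notin> ideal_fibre \<Phi> S \<mu>}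
          = card {I'. ideal_covers \<Phi> S I' I \<and> I' \<notin> ideal_fibre \<Phi> S \<mu>})
    \<and> (simply_laced \<Phi> \<longrightarrow>
          card {I'. ideal_covers \<Phi> S I' I \<and> I' \<notin> ideal_fibre \<Phi> S \<mu>} = kappa \<Phi> S \<mu>)"
proof -
  interpret based_root_system \<Phi> S by standard (use assms in auto)
  have \<mu>: "\<mu> \<in> long_pos_roots \<Phi> S" "\<mu> \<notin> S" using assms(5) by auto
  hence P: "\<mu> \<in> pos_roots \<Phi> S" by (simp add: long_pos_roots_def)
  \<comment> \<open>The count holds for every member of the fibre with the same right-hand side,
    which gives independence of \<open>I\<close>.\<close>
  show ?thesis
    using card_covers_leaving_fibre[OF \<mu>] card_simple_above_simply_laced[OF _ P \<mu>(2)] assms(6)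
    by (simp add: simple_above_def)
qed

end
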